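(* Suppose that a dynamical system $(X,f)$ is uniquely ergodic and that $p\in\mathbb{N}^+$ is a prime such that $Q_{f^p}^e(X)\neq X$. Then for every $m\geq p$ there exists a non-uniform $A\in C(X,\mathrm{GL}(m))$ (for the system $(X,f)$).
   Context: A dynamical system $(X,f)$ is a compact metric space $X$ together with a homeomorphism $f:X\to X$. It is uniquely ergodic if there is exactly one $f$-invariant Borel probability measure on $X$. $\mathbb{N}^+$ denotes the positive integers. For a dynamical system $(X,h)$, $\mathcal{M}_h(X)$ and $\mathcal{M}_h^e(X)$ denote the sets of $h$-invariant, respectively $h$-ergodic, Borel probability measures on $X$. For $x\in X$, $V_h(x)$ denotes the set of weak$^*$ accumulation points of the sequence of empirical measures $\frac1n\sum_{i=0}^{n-1}\delta_{h^i x}$, $n\in\mathbb{N}^+$. For $\mu\in\mathcal{M}_h(X)$ put $G_{h,\mu}=\{x\in X: V_h(x)=\{\mu\}\}$, and put $Q_h^e(X)=\bigcup_{\mu\in\mathcal{M}_h^e(X)}G_{h,\mu}$. $\mathrm{GL}(m)$ is the set of invertible real $m\times m$ matrices and $C(X,\mathrm{GL}(m))$ is the set of continuous maps $X\to\mathrm{GL}(m)$. For $A\in C(X,\mathrm{GL}(m))$ and $n\geq1$ put $A(n,x)=A(f^{n-1}x)A(f^{n-2}x)\cdots A(x)$. $A$ is uniform if $\frac1n\log\|A(n,x)\|$ converges uniformly on $X$ as $n\to\infty$ (this does not depend on the choice of matrix norm), and non-uniform otherwise. *)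

theory Defs
  imports "HOL-Probability.Probability" "HOL-Computational_Algebra.Primes"
begin

definition dynamical_system :: "'a::metric_space set \<Rightarrow> ('a \<Rightarrow> 'a) \<Rightarrow> bool" where
  "dynamical_system X f \<longleftrightarrow> compact X \<and> (\<exists>g. homeomorphism X X f g)"

definition borel_prob_measures :: "'a::metric_space set \<Rightarrow> 'a measure set" where
  "borel_prob_measures X = {M. prob_space M \<and> sets M = sets (restrict_space borel X)}"

definition invariant_measures :: "'a::metric_space set \<Rightarrow> ('a \<Rightarrow> 'a) \<Rightarrow> 'a measure set" where
  "invariant_measures X h =
     {M \<in> borel_prob_measures X. \<forall>B\<in>sets M. emeasure M (h -` B \<inter> X) = emeasure M B}"

definition ergodic_measures :: "'a::metric_space set \<Rightarrow> ('a \<Rightarrow> 'a) \<Rightarrow> 'a measure set" where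
  "ergodic_measures X h =
     {M \<in> invariant_measures X h.
        \<forall>B\<in>sets M. h -` B \<inter> X = B \<longrightarrow> emeasure M B = 0 \<or> emeasure M B = 1}"

definition uniquely_ergodic :: "'a::metric_space set \<Rightarrow> ('a \<Rightarrow> 'a) \<Rightarrow> bool" where
  "uniquely_ergodic X f \<longleftrightarrow> (\<exists>!M. M \<in> invariant_measures X f)"

definition weak_star_topology :: "'a::metric_space set \<Rightarrow> 'a measure topology" where
  "weak_star_topology X = topology_generated_by
     {{M \<in> borel_prob_measures X. integral\<^sup>L M \<phi> \<in> U} |(\<phi> :: 'a \<Rightarrow> real) U.
        continuous_on X \<phi> \<and> open U}"

text \<open>The empirical measure is the push-forward of the uniform distribution on
  \<open>{0, \<dots>, n - 1}\<close> along the orbit map; the lemma below identifies it with the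
  average of Dirac measures.\<close>

definition empirical_measure ::
    "'a::metric_space set \<Rightarrow> ('a \<Rightarrow> 'a) \<Rightarrow> nat \<Rightarrow> 'a \<Rightarrow> 'a measure" where
  "empirical_measure X h n x =
     distr (uniform_count_measure {..<n}) (restrict_space borel X) (\<lambda>i. (h ^^ i) x)"

lemma emeasure_empirical_measure:
  assumes "n > 0" "x \<in> X" "h ` X \<subseteq> X" "B \<in> sets (restrict_space borel X)"
  shows "emeasure (empirical_measure X h n x) B =
    (\<Sum>i<n. emeasure (return (restrict_space borel X) ((h ^^ i) x)) B) / of_nat n"
proof -
  have orbit: "(h ^^ i) x \<in> X" for i
    by (induction i) (use assms in auto)
  then have "(\<lambda>i. (h ^^ i) x) \<in> measurable (uniform_count_measure {..<n}) (restrict_space borel X)"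
    by (auto simp: measurable_def space_uniform_count_measure sets_uniform_count_measure
        space_restrict_space)
  then have "emeasure (empirical_measure X h n x) B =
      emeasure (uniform_count_measure {..<n}) {i \<in> {..<n}. (h ^^ i) x \<in> B}"
    using assms unfolding empirical_measure_def
    by (subst emeasure_distr)
       (auto simp: space_uniform_count_measure intro!: arg_cong[where f = "emeasure _"])
  also have "\<dots> = of_nat (card {i \<in> {..<n}. (h ^^ i) x \<in> B}) / of_nat n"
    using assms by (subst emeasure_uniform_count_measure)
       (auto simp: divide_ennreal[symmetric] ennreal_of_nat_eq_real_of_nat)
  also have "of_nat (card {i \<in> {..<n}. (h ^^ i) x \<in> B}) =
      (\<Sum>i<n. emeasure (return (restrict_space borel X) ((h ^^ i) x)) B)"
    using assms by (simp add: indicator_def sum.If_cases Int_def)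
  finally show ?thesis .
qed

text \<open>Accumulation points of the sequence of empirical measures: every neighbourhood of
  \<open>M\<close> contains infinitely many terms.\<close>

definition empirical_limits ::
    "'a::metric_space set \<Rightarrow> ('a \<Rightarrow> 'a) \<Rightarrow> 'a \<Rightarrow> 'a measure set" where
  "empirical_limits X h x =
     {M \<in> borel_prob_measures X. \<forall>U. openin (weak_star_topology X) U \<and> M \<in> U \<longrightarrow>
        (\<exists>\<^sub>F n in sequentially. empirical_measure X h n x \<in> U)}"

definition generic_points ::
    "'a::metric_space set \<Rightarrow> ('a \<Rightarrow> 'a) \<Rightarrow> 'a measure \<Rightarrow> 'a set" where
  "generic_points X h M = {x \<in> X. empirical_limits X h x = {M}}"

definition ergodic_generic_points :: "'a::metric_space set \<Rightarrow> ('a \<Rightarrow> 'a) \<Rightarrow> 'a set" where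
  "ergodic_generic_points X h = (\<Union>M\<in>ergodic_measures X h. generic_points X h M)"

definition continuous_GL :: "'a::metric_space set \<Rightarrow> ('a \<Rightarrow> real^'m^'m) set" where
  "continuous_GL X = {A. continuous_on X A \<and> (\<forall>x\<in>X. invertible (A x))}"

primrec cocycle :: "('a \<Rightarrow> 'a) \<Rightarrow> ('a \<Rightarrow> real^'m^'m) \<Rightarrow> nat \<Rightarrow> 'a \<Rightarrow> real^'m^'m" where
  "cocycle f A 0 x = mat 1"
| "cocycle f A (Suc n) x = A ((f ^^ n) x) ** cocycle f A n x"

text \<open>The norm is the Euclidean (Frobenius) norm on matrices; any other matrix norm gives the
  same notion, since all of them are equivalent.\<close>

definition uniform_cocycle ::
    "'a::metric_space set \<Rightarrow> ('a \<Rightarrow> 'a) \<Rightarrow> ('a \<Rightarrow> real^'m^'m) \<Rightarrow> bool" where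
  "uniform_cocycle X f A \<longleftrightarrow>
     uniformly_convergent_on X (\<lambda>n x. ln (norm (cocycle f A n x)) / real n)"

end

theory Submission
  imports Defs
begin

text \<open>Put \<open>h = f\<^sup>p\<close>. For continuous \<open>\<phi> \<ge> 0\<close> let \<open>A(x)\<close> be the permutation matrix of a
  \<open>p\<close>-cycle with one entry replaced by \<open>exp (\<phi> x)\<close>. The entries of \<open>A(pN, x)\<close> are
  exponentials of the Birkhoff sums of \<open>\<phi>\<close> under \<open>h\<close> along the points \<open>f\<^sup>i x\<close>, \<open>i < p\<close>, so
  \<open>A\<close> is uniform only if the maximum over \<open>i < p\<close> of the corresponding averages converges
  uniformly. The limit is continuous and \<open>f\<close>-invariant, hence a constant \<open>c\<close>. It
  satisfies \<open>\<integral>\<phi> d\<nu> \<le> c\<close> for every \<open>h\<close>-invariant \<open>\<nu>\<close>, and \<open>c\<close> is the largest of the integrals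
  \<open>\<integral>\<phi> \<circ> f\<^sup>i d\<mu>\<close>, \<open>i < p\<close>, for every limit \<open>\<mu>\<close> of \<open>h\<close>-empirical measures.

  If all cocycles are uniform, each such \<open>\<mu>\<close> therefore dominates all \<open>h\<close>-invariant measures up to
  translation by \<open>f\<^sup>i\<close>. Testing this on conditional measures of \<open>\<mu>\<close> shows that \<open>\<mu>\<close> is
  ergodic; testing it on other limits shows that all limits at a given point are translates of
  \<open>\<mu>\<close>. They are finitely many, while the set of limits is connected, so there is only one and
  every point is generic for an ergodic measure.\<close>

section \<open>Compact metric spaces as images of compact sets of reals\<close>

text \<open>At the first index \<open>m\<close> where the digits differ, the difference of the sums
  gets a term of size \<open>(1/3)^m\<close>, while all later terms together contribute at most half
  of that. So a disagreement at \<open>m \<le> N\<close> keeps the sums at least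
  \<open>(1/3)^N / 2\<close> apart. Base 3 instead of 2 is what creates this gap.\<close>

lemma ternary_expansion_agree:
  fixes a b :: "nat \<Rightarrow> real"
  assumes "\<And>n. a n \<in> {0, 1}" "\<And>n. b n \<in> {0, 1}"
    and close: "\<bar>(\<Sum>n. (1/3)^n * a n) - (\<Sum>n. (1/3)^n * b n)\<bar> < (1/3)^N / 2"
    and "n \<le> N"
  shows "a n = b n"
proof (rule ccontr)
  assume "a n \<noteq> b n"
  define d where "d k = a k - b k" for k
  have d_abs: "\<bar>d k\<bar> \<le> 1" for k
    using assms(1)[of k] assms(2)[of k] by (auto simp: d_def)
  define m where "m = (LEAST k. a k \<noteq> b k)"
  have m: "a m \<noteq> b m" "m \<le> n"
    unfolding m_def using \<open>a n \<noteq> b n\<close> by (rule LeastI, rule Least_le)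
  have below: "d k = 0" if "k < m" for k
    using not_less_Least[of k "\<lambda>k. a k \<noteq> b k"] that by (simp add: m_def d_def)
  have geo: "summable (\<lambda>k. (1/3::real)^k)"
    by (rule summable_geometric) simp
  have summ: "summable (\<lambda>k. (1/3)^k * c k)" if "\<And>k. \<bar>c k\<bar> \<le> 1" for c :: "nat \<Rightarrow> real"
    by (rule summable_comparison_test'[OF geo, of 0])
      (use that in \<open>simp add: abs_mult mult_left_le\<close>)
  have abs1: "\<bar>a k\<bar> \<le> 1" "\<bar>b k\<bar> \<le> 1" for k
    using assms(1)[of k] assms(2)[of k] by auto
  have diff: "(\<Sum>n. (1/3)^n * a n) - (\<Sum>n. (1/3)^n * b n) = (\<Sum>k. (1/3)^k * d k)"
    using suminf_diff[OF summ[OF abs1(1)] summ[OF abs1(2)]] by (simp add: d_def algebra_simps)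
  have split: "(\<Sum>k. (1/3)^k * d k) = (\<Sum>k. (1/3)^(k + Suc m) * d (k + Suc m)) + (\<Sum>k<Suc m. (1/3)^k * d k)"
    by (rule suminf_split_initial_segment[OF summ[OF d_abs]])
  have head: "(\<Sum>k<Suc m. (1/3)^k * d k) = (1/3)^m * d m"
    using below by simp
  have tail_sums: "(\<lambda>k. (1/3::real)^(k + Suc m)) sums ((1/3)^m / 2)"
    using sums_mult2[OF geometric_sums[of "1/3::real"], of "(1/3)^Suc m"]
    by (simp add: power_add mult.commute field_simps)
  have "\<bar>\<Sum>k. (1/3)^(k + Suc m) * d (k + Suc m)\<bar> \<le> (\<Sum>k. (1/3)^(k + Suc m))"
  proof -
    have "norm ((1/3)^(k + Suc m) * d (k + Suc m)) \<le> (1/3)^(k + Suc m)" for k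
      using d_abs[of "k + Suc m"] by (simp add: abs_mult mult_left_le)
    then show ?thesis
      using norm_suminf_le[of "\<lambda>k. (1/3)^(k + Suc m) * d (k + Suc m)" "\<lambda>k. (1/3)^(k + Suc m)"]
        sums_summable[OF tail_sums] by simp
  qed
  then have "\<bar>\<Sum>k. (1/3)^(k + Suc m) * d (k + Suc m)\<bar> \<le> (1/3)^m / 2"
    using sums_unique[OF tail_sums] by simp
  moreover have "\<bar>(1/3)^m * d m\<bar> = (1/3)^m"
    using m(1) assms(1)[of m] assms(2)[of m] by (auto simp: d_def abs_mult)
  ultimately have "(1/3)^m / 2 \<le> \<bar>\<Sum>k. (1/3)^k * d k\<bar>"
    unfolding split head by linarith
  moreover have "(1/3::real)^N \<le> (1/3)^m"
    using m(2) \<open>n \<le> N\<close> by (intro power_decreasing) auto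
  ultimately show False
    using close unfolding diff by linarith
qed

text \<open>Total boundedness provides countably many balls, finitely many of each radius
  \<open>1 / Suc m\<close>, that cover \<open>X\<close> at every scale. The ternary digits of
  \<open>c x\<close> record which balls contain \<open>x\<close>. The code need not be continuous;
  what matters is that points with close codes are close.\<close>

lemma compact_real_code:
  fixes X :: "'a::metric_space set"
  assumes "compact X"
  obtains c :: "'a \<Rightarrow> real"
  where "\<And>x. 0 \<le> c x \<and> c x \<le> 2"
    and "\<And>e. e > 0 \<Longrightarrow> \<exists>d>0. \<forall>x\<in>X. \<forall>y\<in>X. \<bar>c x - c y\<bar> < d \<longrightarrow> dist x y < e"
proof -
  have "\<exists>F. finite F \<and> X \<subseteq> (\<Union>z\<in>F. ball z (1 / Suc m))" for m
    using assms unfolding compact_eq_totally_bounded by simp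
  then obtain F where F: "\<And>m. finite (F m)" "\<And>m. X \<subseteq> (\<Union>z\<in>F m. ball z (1 / Suc m))"
    by metis
  \<comment> \<open>The extra pair makes \<open>P\<close> nonempty even if every \<open>F m\<close>
    is empty; its ball is just one more membership test.\<close>
  define P where "P = insert (0, undefined) (SIGMA m:UNIV. F m)"
  have "countable (SIGMA m:UNIV. F m)"
    by (rule countable_SIGMA) (auto intro: countable_finite F)
  then have P: "countable P" "P \<noteq> {}"
    unfolding P_def by auto
  define A where "A n = ball (snd (from_nat_into P n)) (1 / Suc (fst (from_nat_into P n)))" for n
  define c :: "'a \<Rightarrow> real" where "c x = (\<Sum>n. (1/3)^n * indicator (A n) x)" for x
  have geo: "(\<lambda>k. (1/3::real)^k) sums (3/2)"
    using geometric_sums[of "1/3::real"] by simp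
  have summ: "summable (\<lambda>n. (1/3)^n * indicator (A n) x :: real)" for x
    by (rule summable_comparison_test'[OF sums_summable[OF geo], of 0])
      (simp add: indicator_def)
  have "0 \<le> c x" for x
    unfolding c_def by (intro suminf_nonneg summ) auto
  moreover have "c x \<le> 2" for x
  proof -
    have "c x \<le> (\<Sum>k. (1/3)^k)"
      unfolding c_def by (intro suminf_le summ sums_summable[OF geo]) (auto simp: indicator_def)
    then show ?thesis using sums_unique[OF geo] by simp
  qed
  moreover have "\<exists>d>0. \<forall>x\<in>X. \<forall>y\<in>X. \<bar>c x - c y\<bar> < d \<longrightarrow> dist x y < e" if "e > 0" for e
  proof -
    obtain m where m: "inverse (real (Suc m)) < e / 2"
      using reals_Archimedean[of "e/2"] \<open>e > 0\<close> by auto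
    \<comment> \<open>\<open>N\<close> bounds the positions of the finitely many balls of radius
      \<open>1 / Suc m\<close>, so codes closer than \<open>(1/3)^N / 2\<close> agree on all of them
      and the two points share such a ball.\<close>
    have fin: "finite (to_nat_on P ` (Pair m ` F m))"
      using F by auto
    obtain N where N: "\<And>z. z \<in> F m \<Longrightarrow> to_nat_on P (m, z) \<le> N"
      using finite_nat_set_iff_bounded_le[THEN iffD1, OF fin] by auto
    have "dist x y < e" if xy: "x \<in> X" "y \<in> X" "\<bar>c x - c y\<bar> < (1/3)^N / 2" for x y
    proof -
      obtain z where z: "z \<in> F m" "x \<in> ball z (1 / Suc m)"
        using F(2)[of m] xy by blast
      define n where "n = to_nat_on P (m, z)"
      have "from_nat_into P n = (m, z)"
        unfolding n_def by (rule from_nat_into_to_nat_on[OF P(1)]) (use z in \<open>simp add: P_def\<close>)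
      then have An: "A n = ball z (1 / Suc m)"
        by (simp add: A_def)
      have "(indicator (A n) x :: real) = indicator (A n) y"
        by (rule ternary_expansion_agree[where a="\<lambda>n. indicator (A n) x" and b="\<lambda>n. indicator (A n) y"])
          (use xy(3) N[OF z(1)] in \<open>auto simp: c_def n_def indicator_def\<close>)
      then have "y \<in> ball z (1 / Suc m)"
        using z(2) unfolding An by (auto simp: indicator_def split: if_splits)
      then have "dist z x < e / 2" "dist z y < e / 2"
        using z(2) m by (auto simp: inverse_eq_divide)
      then show ?thesis by (rule dist_triangle_half_r)
    qed
    then show ?thesis
      by (intro exI[of _ "(1/3)^N / 2"]) auto
  qed
  ultimately show thesis by (intro that[of c]) auto
qed

lemma compact_real_parametrization:
  fixes X :: "'a::metric_space set"
  assumes "compact X"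
  obtains K :: "real set" and \<pi> :: "real \<Rightarrow> 'a" and c :: "'a \<Rightarrow> real"
  where "compact K" "continuous_on K \<pi>" "\<pi> ` K \<subseteq> X" "c ` X \<subseteq> K"
    "\<And>x. x \<in> X \<Longrightarrow> \<pi> (c x) = x"
proof -
  obtain c :: "'a \<Rightarrow> real" where c01: "\<And>x. 0 \<le> c x \<and> c x \<le> 2"
    and c: "\<And>e. e > 0 \<Longrightarrow> \<exists>d>0. \<forall>x\<in>X. \<forall>y\<in>X. \<bar>c x - c y\<bar> < d \<longrightarrow> dist x y < e"
    using compact_real_code[OF assms] by blast
  \<comment> \<open>\<open>G\<close> is the graph of the extended inverse: \<open>x\<close> is a
    limit of points whose codes tend to \<open>t\<close>. Compactness gives existence
    (\<open>G_ex\<close>); the property of the code gives uniform continuity and thereby uniqueness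
    (\<open>G_dist\<close>).\<close>
  define G where "G t x \<longleftrightarrow> x \<in> X \<and> (\<exists>u. (\<forall>n. u n \<in> X) \<and> (\<lambda>n. c (u n)) \<longlonglongrightarrow> t \<and> u \<longlonglongrightarrow> x)" for t x
  define K where "K = closure (c ` X)"
  have "bounded (c ` X)"
    by (rule bounded_subset[of "{0..2}"]) (use c01 in auto)
  then have K: "compact K"
    unfolding K_def by (rule compact_closure[THEN iffD2])
  have G_ex: "\<exists>x. G t x" if "t \<in> K" for t
  proof -
    obtain v where v: "\<And>n. v n \<in> c ` X" "v \<longlonglongrightarrow> t"
      using \<open>t \<in> K\<close> unfolding K_def closure_sequential by auto
    have "\<forall>n. \<exists>z. z \<in> X \<and> v n = c z" using v(1) by blast
    then obtain u where u: "\<And>n. u n \<in> X" "\<And>n. v n = c (u n)"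
      by metis
    obtain x r where "x \<in> X" "strict_mono r" "(u \<circ> r) \<longlonglongrightarrow> x"
      using assms u(1) unfolding compact_def by blast
    moreover have "(\<lambda>n. c (u (r n))) \<longlonglongrightarrow> t"
      using LIMSEQ_subseq_LIMSEQ[OF v(2) \<open>strict_mono r\<close>] u(2) by (simp add: comp_def)
    ultimately show ?thesis
      unfolding G_def using u(1) by (intro exI[of _ x] conjI exI[of _ "u \<circ> r"]) (auto simp: comp_def)
  qed
  have G_dist: "\<exists>d>0. \<forall>t x s y. G t x \<and> G s y \<and> \<bar>t - s\<bar> < d \<longrightarrow> dist x y \<le> e" if "e > 0" for e
  proof -
    obtain d where d: "d > 0" "\<And>x y. x \<in> X \<Longrightarrow> y \<in> X \<Longrightarrow> \<bar>c x - c y\<bar> < d \<Longrightarrow> dist x y < e"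
      using c[OF \<open>e > 0\<close>] by blast
    have "dist x y \<le> e" if "G t x" "G s y" "\<bar>t - s\<bar> < d" for t x s y
    proof -
      obtain u where u: "\<And>n. u n \<in> X" "(\<lambda>n. c (u n)) \<longlonglongrightarrow> t" "u \<longlonglongrightarrow> x"
        using \<open>G t x\<close> unfolding G_def by blast
      obtain v where v: "\<And>n. v n \<in> X" "(\<lambda>n. c (v n)) \<longlonglongrightarrow> s" "v \<longlonglongrightarrow> y"
        using \<open>G s y\<close> unfolding G_def by blast
      have "(\<lambda>n. \<bar>c (u n) - c (v n)\<bar>) \<longlonglongrightarrow> \<bar>t - s\<bar>"
        by (intro tendsto_intros u v)
      then have "\<forall>\<^sub>F n in sequentially. \<bar>c (u n) - c (v n)\<bar> < d"
        using that(3) by (rule order_tendstoD)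
      then have "\<forall>\<^sub>F n in sequentially. dist (u n) (v n) \<le> e"
        by eventually_elim (use d(2) u(1) v(1) in \<open>auto intro: less_imp_le\<close>)
      moreover have "(\<lambda>n. dist (u n) (v n)) \<longlonglongrightarrow> dist x y"
        by (intro tendsto_intros u v)
      ultimately show ?thesis
        by (intro tendsto_upperbound) auto
    qed
    then show ?thesis using d(1) by blast
  qed
  define \<pi> where "\<pi> t = (SOME x. G t x)" for t
  have \<pi>: "G t (\<pi> t)" if "t \<in> K" for t
    unfolding \<pi>_def by (rule someI_ex[OF G_ex[OF that]])
  have "continuous_on K \<pi>"
    unfolding continuous_on_iff
  proof (intro ballI allI impI)
    fix t e :: real assume "t \<in> K" "e > 0"
    obtain d where "d > 0" and d: "\<And>t x s y. G t x \<Longrightarrow> G s y \<Longrightarrow> \<bar>t - s\<bar> < d \<Longrightarrow> dist x y \<le> e/2"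
      using G_dist[of "e/2"] \<open>e > 0\<close> by auto
    then have "\<forall>s\<in>K. dist s t < d \<longrightarrow> dist (\<pi> s) (\<pi> t) \<le> e/2"
      using d[OF \<pi> \<pi>] \<open>t \<in> K\<close> by (auto simp: dist_real_def)
    then show "\<exists>d>0. \<forall>s\<in>K. dist s t < d \<longrightarrow> dist (\<pi> s) (\<pi> t) < e"
      using \<open>d > 0\<close> \<open>e > 0\<close> by (intro exI[of _ d]) force
  qed
  moreover have "\<pi> (c x) = x" if "x \<in> X" for x
  proof -
    have "G (c x) x"
      unfolding G_def using that by (auto intro!: exI[of _ "\<lambda>_. x"])
    moreover have "G (c x) (\<pi> (c x))"
      by (rule \<pi>) (use that closure_subset[of "c ` X"] in \<open>auto simp: K_def\<close>)
    ultimately have "dist (\<pi> (c x)) x \<le> e" if "e > 0" for e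
      using G_dist[OF that] by force
    then show ?thesis
      by (metis dense_ge dist_le_zero_iff)
  qed
  ultimately show thesis
    using K \<pi> by (intro that[of K \<pi> c]) (use closure_subset[of "c ` X"] in \<open>auto simp: G_def K_def\<close>)
qed

section \<open>Borel probability measures on a compact metric space\<close>

lemma borel_prob_measuresD:
  assumes "M \<in> borel_prob_measures X"
  shows "prob_space M" "sets M = sets (restrict_space borel X)" "space M = X"
  using assms sets_eq_imp_space_eq[of M "restrict_space borel X"]
  by (auto simp: borel_prob_measures_def space_restrict_space)

lemma borel_measurable_continuous:
  fixes \<phi> :: "'a::metric_space \<Rightarrow> 'b::topological_space"
  assumes "M \<in> borel_prob_measures X" "continuous_on X \<phi>"
  shows "\<phi> \<in> borel_measurable M"
  using borel_measurable_continuous_on_restrict[OF assms(2)]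
    measurable_cong_sets[OF borel_prob_measuresD(2)[OF assms(1)] refl] by blast

lemma continuous_bounded_on_compact:
  fixes \<phi> :: "'a::metric_space \<Rightarrow> real"
  assumes "compact X" "continuous_on X \<phi>"
  obtains B where "B > 0" "\<And>x. x \<in> X \<Longrightarrow> \<bar>\<phi> x\<bar> \<le> B"
  using compact_imp_bounded[OF compact_continuous_image[OF assms(2,1)]]
  unfolding bounded_pos by auto

lemma integrable_continuous:
  fixes \<phi> :: "'a::metric_space \<Rightarrow> real"
  assumes "compact X" "M \<in> borel_prob_measures X" "continuous_on X \<phi>"
  shows "integrable M \<phi>"
proof -
  interpret prob_space M using borel_prob_measuresD[OF assms(2)] by simp
  obtain B where "\<And>x. x \<in> X \<Longrightarrow> \<bar>\<phi> x\<bar> \<le> B"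
    using continuous_bounded_on_compact[OF assms(1,3)] by metis
  then show ?thesis
    by (intro integrable_const_bound[of _ B] borel_measurable_continuous[OF assms(2,3)])
      (auto simp: borel_prob_measuresD(3)[OF assms(2)])
qed

text \<open>The points are sent to the line by \<open>c\<close>, where they all lie in the compact
  set \<open>K\<close>, so the discrete distributions \<open>E k\<close> are tight and have a weakly
  convergent subsequence. The limit is carried by \<open>K\<close> and is brought back to
  \<open>X\<close> along \<open>\<pi>\<close>.\<close>

lemma weak_star_sequential_compactness:
  fixes X :: "'a::metric_space set" and z :: "nat \<Rightarrow> nat \<Rightarrow> 'a" and n :: "nat \<Rightarrow> nat"
  assumes "compact X" "\<And>k i. z k i \<in> X" "\<And>k. n k > 0"
  obtains r M where "strict_mono (r :: nat \<Rightarrow> nat)" "M \<in> borel_prob_measures X"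
    "\<And>\<phi> :: 'a \<Rightarrow> real. continuous_on X \<phi> \<Longrightarrow>
       (\<lambda>k. (\<Sum>i<n (r k). \<phi> (z (r k) i)) / n (r k)) \<longlonglongrightarrow> integral\<^sup>L M \<phi>"
proof -
  obtain K :: "real set" and \<pi> and c :: "'a \<Rightarrow> real" where
    K: "compact K" "continuous_on K \<pi>" "\<pi> ` K \<subseteq> X" "c ` X \<subseteq> K"
    and \<pi>c: "\<And>x. x \<in> X \<Longrightarrow> \<pi> (c x) = x"
    using compact_real_parametrization[OF assms(1)] by blast
  define E where "E k = distr (uniform_count_measure {..<n k}) (borel :: real measure) (\<lambda>i. c (z k i))" for k
  have meas: "(\<lambda>i. c (z k i)) \<in> measurable (uniform_count_measure {..<n k}) borel" for k
    by (auto simp: measurable_def space_uniform_count_measure sets_uniform_count_measure)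
  have pu: "prob_space (uniform_count_measure {..<n k})" for k
    using assms(3)[of k] by (intro prob_space_uniform_count_measure) auto
  have rd: "real_distribution (E k)" for k
    unfolding E_def using prob_space.prob_space_distr[OF pu meas]
    by (auto simp: real_distribution_def real_distribution_axioms_def)
  have int: "integral\<^sup>L (E k) \<psi> = (\<Sum>i<n k. \<psi> (c (z k i))) / n k"
    if "continuous_on UNIV \<psi>" for \<psi> :: "real \<Rightarrow> real" and k
    unfolding E_def
    by (subst integral_distr[OF meas borel_measurable_continuous_onI[OF that]])
      (simp add: integral_uniform_count_measure)
  obtain C where C: "C > 0" "\<And>t. t \<in> K \<Longrightarrow> \<bar>t\<bar> \<le> C"
    using compact_imp_bounded[OF K(1)] unfolding bounded_pos by auto
  have "tight E"
    unfolding tight_def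
  proof (intro conjI allI impI rd)
    fix e :: real assume "e > 0"
    \<comment> \<open>\<open>K\<close> lies in \<open>{-C..C}\<close>; the left end is lowered by 1
      so that the half-open interval required by \<open>tight\<close> still contains
      \<open>-C\<close>.\<close>
    have "measure (E k) {-(C+1)<..C} = 1" for k
    proof -
      interpret real_distribution "E k" by (rule rd)
      have "c (z k i) \<in> {-(C+1)<..C}" for i
        using C(2)[of "c (z k i)"] K(4) assms(2)[of k i] by auto
      then have "AE t in E k. t \<in> {-(C+1)<..C}"
        unfolding E_def by (subst AE_distr_iff[OF meas]) auto
      then show ?thesis
        by (subst prob_eq_1) auto
    qed
    then show "\<exists>a b. a < b \<and> (\<forall>k. 1 - e < measure (E k) {a<..b})"
      using C(1) \<open>e > 0\<close> by (intro exI[of _ "-(C+1)"] exI[of _ C]) auto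
  qed
  from tight_imp_convergent_subsubsequence[OF this strict_mono_id]
  obtain r N where r: "strict_mono r" "real_distribution N" "weak_conv_m (\<lambda>k. E (r k)) N"
    by (auto simp: comp_def)
  interpret N: real_distribution N by (rule r(2))
  have conv: "(\<lambda>k. integral\<^sup>L (E (r k)) \<psi>) \<longlonglongrightarrow> integral\<^sup>L N \<psi>"
    if "continuous_on UNIV \<psi>" "\<And>t. norm (\<psi> t) \<le> B" for \<psi> :: "real \<Rightarrow> real" and B
    using weak_conv_imp_integral_bdd_continuous_conv[of "\<lambda>k. E (r k)" N \<psi> B] rd r that
    by (simp add: continuous_on_eq_continuous_at)
  have zK: "c (z k i) \<in> K" for k i
    using K(4) assms(2) by blast
  \<comment> \<open>The truncated distance to \<open>K\<close> is bounded and continuous and has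
    integral 0 against every \<open>E k\<close>, hence against \<open>N\<close>. Being nonnegative,
    it vanishes almost everywhere, and \<open>K\<close> is closed.\<close>
  have AE_K: "AE t in N. t \<in> K"
  proof -
    define \<psi> where "\<psi> t = min 1 (infdist t K)" for t
    have \<psi>: "continuous_on UNIV \<psi>" "\<And>t. norm (\<psi> t) \<le> 1" "\<And>t. 0 \<le> \<psi> t"
      unfolding \<psi>_def by (auto intro!: continuous_intros simp: infdist_nonneg)
    have "integral\<^sup>L (E k) \<psi> = 0" for k
      unfolding int[OF \<psi>(1)] using zK by (simp add: \<psi>_def)
    then have "integral\<^sup>L N \<psi> = 0"
      using LIMSEQ_unique[OF conv[OF \<psi>(1,2)], of 0] by simp
    moreover have "integrable N \<psi>"
      using \<psi> borel_measurable_continuous_onI[OF \<psi>(1)]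
      by (intro N.integrable_const_bound[of _ 1]) auto
    ultimately have "AE t in N. \<psi> t = 0"
      using integral_nonneg_eq_0_iff_AE[of N \<psi>] \<psi>(3) by auto
    then show ?thesis
    proof eventually_elim
      case (elim t)
      then have "infdist t K = 0" by (auto simp: \<psi>_def min_def split: if_splits)
      then show ?case
        using in_closed_iff_infdist_zero[OF compact_imp_closed[OF K(1)]] zK by auto
    qed
  qed
  \<comment> \<open>Outside \<open>K\<close>, a null set of \<open>N\<close>, the value is an
    arbitrary point of \<open>X\<close>, so that \<open>\<pi>'\<close> maps the whole line into
    \<open>X\<close>.\<close>
  define \<pi>' where "\<pi>' t = (if t \<in> K then \<pi> t else z 0 0)" for t
  have K_borel: "K \<in> sets borel"
    using compact_imp_closed[OF K(1)] by simp
  have \<pi>'_borel: "\<pi>' \<in> borel_measurable borel"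
    unfolding \<pi>'_def using K_borel
    by (intro measurable_If_restrict_space_iff[THEN iffD2] conjI borel_measurable_continuous_on_restrict) (auto simp: K(2))
  have \<pi>'_meas: "\<pi>' \<in> measurable N (restrict_space borel X)"
    using \<pi>'_borel K(3) assms(2) by (intro measurable_restrict_space2) (auto simp: \<pi>'_def image_subset_iff)
  define M where "M = distr N (restrict_space borel X) \<pi>'"
  have M: "M \<in> borel_prob_measures X"
    unfolding borel_prob_measures_def M_def
    using N.prob_space_distr[OF \<pi>'_meas] by simp
  have "(\<lambda>k. (\<Sum>i<n (r k). \<phi> (z (r k) i)) / n (r k)) \<longlonglongrightarrow> integral\<^sup>L M \<phi>"
    if \<phi>: "continuous_on X \<phi>" for \<phi> :: "'a \<Rightarrow> real"
  proof -
    obtain B where B: "B > 0" "\<And>x. x \<in> X \<Longrightarrow> \<bar>\<phi> x\<bar> \<le> B"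
      using continuous_bounded_on_compact[OF assms(1) \<phi>] by metis
    \<comment> \<open>Weak convergence tests bounded continuous functions on the whole line, so
      \<open>\<phi> \<circ> \<pi>\<close> is extended from \<open>K\<close> by Tietze with the same
      bound.\<close>
    have "continuous_on K (\<lambda>t. \<phi> (\<pi> t))"
      by (rule continuous_on_compose2[OF \<phi> K(2,3)])
    moreover have "closedin (top_of_set UNIV) K"
      using compact_imp_closed[OF K(1)] by simp
    moreover have "norm (\<phi> (\<pi> t)) \<le> B" if "t \<in> K" for t
      using B(2)[of "\<pi> t"] K(3) that by auto
    ultimately obtain \<psi> where \<psi>: "continuous_on UNIV \<psi>" "\<And>t. t \<in> K \<Longrightarrow> \<psi> t = \<phi> (\<pi> t)"
      "\<And>t. norm (\<psi> t) \<le> B"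
      using Tietze[of K "\<lambda>t. \<phi> (\<pi> t)" UNIV B] less_imp_le[OF B(1)] by auto
    have "integral\<^sup>L (E k) \<psi> = (\<Sum>i<n k. \<phi> (z k i)) / n k" for k
      unfolding int[OF \<psi>(1)] using zK \<psi>(2) \<pi>c assms(2) by simp
    moreover have "integral\<^sup>L N \<psi> = integral\<^sup>L M \<phi>"
    proof -
      have "\<phi> \<in> borel_measurable (restrict_space borel X)"
        by (rule borel_measurable_continuous_on_restrict[OF \<phi>])
      then have "integral\<^sup>L M \<phi> = (\<integral>t. \<phi> (\<pi>' t) \<partial>N)"
        unfolding M_def by (rule integral_distr[OF \<pi>'_meas])
      also have "\<dots> = integral\<^sup>L N \<psi>"
      proof (rule integral_cong_AE)
        show "(\<lambda>t. \<phi> (\<pi>' t)) \<in> borel_measurable N"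
          using \<open>\<phi> \<in> borel_measurable (restrict_space borel X)\<close> \<pi>'_meas by measurable
        show "\<psi> \<in> borel_measurable N"
          using borel_measurable_continuous_onI[OF \<psi>(1)] by simp
        show "AE t in N. \<phi> (\<pi>' t) = \<psi> t"
          using AE_K by eventually_elim (simp add: \<pi>'_def \<psi>(2))
      qed
      finally show ?thesis ..
    qed
    ultimately show ?thesis
      using conv[OF \<psi>(1,3)] by simp
  qed
  then show thesis using r(1) M by (rule_tac that)
qed

section \<open>Regularity, and comparison of measures through integrals of continuous
  functions\<close>

lemma sets_borel_prob_measure_closed:
  assumes "compact X" "M \<in> borel_prob_measures X"
  shows "B \<in> sets M \<longleftrightarrow> B \<in> sets borel \<and> B \<subseteq> X"
  using borel_prob_measuresD(2)[OF assms(2)] compact_imp_closed[OF assms(1)]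
  by (auto simp: sets_restrict_space_iff)

lemma open_countable_Union_closed:
  fixes U :: "'a::metric_space set"
  assumes "open U"
  obtains C :: "nat \<Rightarrow> 'a set" where "\<And>n. closed (C n)" "incseq C" "(\<Union>n. C n) = U"
proof (cases "U = UNIV")
  \<comment> \<open>The full space is treated apart because \<open>infdist\<close> to the empty
    complement is 0 by convention.\<close>
  case True
  then show thesis by (intro that[of "\<lambda>_. UNIV"]) auto
next
  case False
  then have ne: "- U \<noteq> {}" by auto
  define C where "C n = {x. infdist x (- U) \<ge> 1 / Suc n}" for n
  have "closed (C n)" for n
    unfolding C_def by (intro closed_Collect_le continuous_intros)
  moreover have "incseq C"
    unfolding incseq_def C_def
  proof (intro allI impI subsetI CollectI, unfold mem_Collect_eq)
    fix m n :: nat and x assume "m \<le> n" "1 / Suc m \<le> infdist x (- U)"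
    moreover have "1 / real (Suc n) \<le> 1 / Suc m"
      using \<open>m \<le> n\<close> by (simp add: frac_le)
    ultimately show "1 / Suc n \<le> infdist x (- U)" by linarith
  qed
  moreover have "(\<Union>n. C n) = U"
  proof (intro set_eqI iffI)
    fix x assume "x \<in> (\<Union>n. C n)"
    then obtain n where "infdist x (- U) \<ge> 1 / Suc n" by (auto simp: C_def)
    then have "infdist x (- U) > 0" by (rule less_le_trans[rotated]) simp
    then show "x \<in> U" by (auto intro: ccontr)
  next
    fix x assume "x \<in> U"
    then have "infdist x (- U) > 0"
      using in_closed_iff_infdist_zero[of "- U" x] assms ne infdist_nonneg[of x "- U"]
      by (simp add: closed_Compl order.strict_iff_order)
    then obtain n where "inverse (real (Suc n)) < infdist x (- U)"
      using reals_Archimedean by blast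
    then show "x \<in> (\<Union>n. C n)"
      by (auto simp: C_def inverse_eq_divide intro!: exI[of _ n])
  qed
  ultimately show thesis by (rule that)
qed

text \<open>The sets with such approximations contain the open sets and form a \<sigma>-algebra.
  Complementation exchanges the closed and the open set. For a countable union one half of
  \<open>e\<close> is distributed geometrically over the pieces and the other half pays for making
  the inner set closed.\<close>

lemma closed_open_regular:
  fixes M :: "'a::metric_space measure"
  assumes "finite_measure M" "sets M = sets borel" "B \<in> sets borel" "e > 0"
  shows "\<exists>C U. closed C \<and> open U \<and> C \<subseteq> B \<and> B \<subseteq> U \<and> measure M (U - C) < e"
proof -
  interpret finite_measure M by fact
  note [simp] = assms(2)
  have "B \<in> sigma_sets UNIV {U. open U}"
    using assms(3) by (simp add: borel_def)
  then show ?thesis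
    using \<open>e > 0\<close>
  proof (induction arbitrary: e)
    case (Basic U)
    then have "open U" by simp
    obtain C where C: "\<And>n. closed (C n)" "incseq C" "(\<Union>n. C n) = U"
      using open_countable_Union_closed[OF \<open>open U\<close>] by blast
    have "range C \<subseteq> sets M" using C(1) by auto
    then have "(\<lambda>n. measure M (C n)) \<longlonglongrightarrow> measure M U"
      using finite_Lim_measure_incseq[of C] C by auto
    then have "\<forall>\<^sub>F n in sequentially. measure M U - e < measure M (C n)"
      using \<open>e > 0\<close> by (intro order_tendstoD) auto
    then obtain n where n: "measure M U - e < measure M (C n)"
      by (auto dest: eventually_happens)
    have "measure M (U - C n) = measure M U - measure M (C n)"
      using C \<open>open U\<close> by (intro finite_measure_Diff) auto
    then show ?case
      using C \<open>open U\<close> n by (intro exI[of _ "C n"] exI[of _ U]) auto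
  next
    case Empty
    have "measure M ({} - {}) < e" using Empty by simp
    then show ?case by (intro exI[of _ "{}"] conjI closed_empty open_empty subset_refl)
  next
    case (Compl B)
    obtain C U where CU: "closed C" "open U" "C \<subseteq> B" "B \<subseteq> U" "measure M (U - C) < e"
      using Compl.IH[OF Compl.prems] by blast
    have "- C - (- U) = U - C" by blast
    then have "measure M (- C - (- U)) < e" using CU(5) by simp
    then show ?case
      using CU by (intro exI[of _ "- U"] exI[of _ "- C"] conjI open_Compl closed_Compl) auto
  next
    case (Union B)
    have "\<forall>n. \<exists>C U. closed C \<and> open U \<and> C \<subseteq> B n \<and> B n \<subseteq> U \<and> measure M (U - C) < e / 2 * (1/2)^Suc n"
    proof
      fix n
      have "0 < e / 2 * (1/2)^Suc n" using \<open>e > 0\<close> by simp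
      then show "\<exists>C U. closed C \<and> open U \<and> C \<subseteq> B n \<and> B n \<subseteq> U \<and> measure M (U - C) < e / 2 * (1/2)^Suc n"
        by (rule Union.IH)
    qed
    then obtain C U where CU: "\<And>n. closed (C n)" "\<And>n. open (U n)" "\<And>n. C n \<subseteq> B n"
      "\<And>n. B n \<subseteq> U n" "\<And>n. measure M (U n - C n) < e / 2 * (1/2)^Suc n"
      by metis
    have geo: "(\<lambda>n. e / 2 * (1/2)^Suc n) sums (e / 2)"
      using sums_mult[OF power_half_series, of "e / 2"] by simp
    have summ: "summable (\<lambda>n. measure M (U n - C n))"
      by (rule summable_comparison_test'[OF sums_summable[OF geo], of 0])
        (use CU(5) in \<open>auto intro: less_imp_le\<close>)
    have "measure M (\<Union>n. U n - C n) \<le> (\<Sum>n. measure M (U n - C n))"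
      using CU by (intro finite_measure_subadditive_countably summ) auto
    also have "\<dots> \<le> (\<Sum>n. e / 2 * (1/2)^Suc n)"
      by (intro suminf_le summ sums_summable[OF geo] less_imp_le[OF CU(5)])
    finally have small: "measure M (\<Union>n. U n - C n) \<le> e / 2"
      using sums_unique[OF geo] by simp
    \<comment> \<open>The union of all \<open>C n\<close> need not be closed; finite partial unions
      are, and by continuity from below one of them loses less than \<open>e / 2\<close>.\<close>
    define D where "D n = (\<Union>i\<le>n. C i)" for n
    have D: "closed (D n)" for n
      unfolding D_def using CU by (intro closed_UN) auto
    have "incseq D"
      unfolding D_def incseq_def by (blast intro: order_trans)
    moreover have "range D \<subseteq> sets M" using D by auto
    ultimately have "(\<lambda>n. measure M (D n)) \<longlonglongrightarrow> measure M (\<Union>n. D n)"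
      by (intro finite_Lim_measure_incseq)
    moreover have UD: "(\<Union>n. D n) = (\<Union>n. C n)" by (auto simp: D_def)
    ultimately have "\<forall>\<^sub>F n in sequentially. measure M (\<Union>n. C n) - e / 2 < measure M (D n)"
      using \<open>e > 0\<close> by (intro order_tendstoD) auto
    then obtain n where n: "measure M (\<Union>n. C n) - e / 2 < measure M (D n)"
      by (auto dest: eventually_happens)
    have mU: "(\<Union>n. C n) \<in> sets M" "(\<Union>n. U n - C n) \<in> sets M" "D n \<in> sets M"
      using CU D by auto
    have "(\<Union>n. U n) - D n \<subseteq> (\<Union>n. U n - C n) \<union> ((\<Union>n. C n) - D n)" by auto
    then have "measure M ((\<Union>n. U n) - D n) \<le> measure M ((\<Union>n. U n - C n) \<union> ((\<Union>n. C n) - D n))"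
      using mU by (intro finite_measure_mono) auto
    also have "\<dots> \<le> measure M (\<Union>n. U n - C n) + measure M ((\<Union>n. C n) - D n)"
      using mU by (intro measure_Un_le) auto
    also have "measure M ((\<Union>n. C n) - D n) = measure M (\<Union>n. C n) - measure M (D n)"
      using mU UD by (intro finite_measure_Diff) auto
    finally have "measure M ((\<Union>n. U n) - D n) < e"
      using small n by linarith
    moreover have "D n \<subseteq> (\<Union>n. B n)" using CU(3) by (auto simp: D_def)
    moreover have "(\<Union>n. B n) \<subseteq> (\<Union>n. U n)" using CU(4) by blast
    moreover have "open (\<Union>n. U n)" using CU(2) by auto
    ultimately show ?case
      using D by (intro exI[of _ "D n"] exI[of _ "\<Union>n. U n"] conjI)
  qed
qed

text \<open>\<open>closed_open_regular\<close> is applied to \<open>N\<close>, the push-forward of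
  \<open>M\<close> under the inclusion of \<open>X\<close> into the whole space.\<close>

lemma closed_inner_regular:
  fixes X :: "'a::metric_space set"
  assumes "compact X" "M \<in> borel_prob_measures X" "B \<in> sets M" "e > 0"
  obtains C where "closed C" "C \<subseteq> B" "measure M B - e < measure M C"
proof -
  interpret prob_space M using borel_prob_measuresD[OF assms(2)] by simp
  have sM: "sets M = sets (restrict_space borel X)" and spM: "space M = X"
    using borel_prob_measuresD[OF assms(2)] by auto
  note setsM = sets_borel_prob_measure_closed[OF assms(1,2)]
  have B: "B \<in> sets borel" "B \<subseteq> X" using assms(3) setsM by auto
  have m: "(\<lambda>x. x) \<in> measurable M borel"
    unfolding measurable_cong_sets[OF sM refl] by (intro measurable_restrict_space1) simp
  define N where "N = distr M borel (\<lambda>x. x)"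
  have mN: "measure N S = measure M (S \<inter> X)" if "S \<in> sets borel" for S
    unfolding N_def by (subst measure_distr[OF m]) (auto simp: that spM)
  have "finite_measure N"
    unfolding N_def by (rule finite_measure_distr[OF m])
  moreover have "sets N = sets borel"
    by (simp add: N_def)
  ultimately obtain C U where C: "closed C" "open U" "C \<subseteq> B" "B \<subseteq> U" "measure N (U - C) < e"
    using closed_open_regular[of N B e] B assms(4) by blast
  have "measure M B - measure M C = measure M (B - C)"
    using C B by (subst finite_measure_Diff) (auto simp: setsM)
  also have "\<dots> \<le> measure M ((U - C) \<inter> X)"
    using C B compact_imp_closed[OF assms(1)] by (intro finite_measure_mono) (auto simp: setsM)
  also have "\<dots> < e"
    using C mN[of "U - C"] by simp
  finally show thesis
    using C by (intro that[of C]) auto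
qed

text \<open>The functions \<open>max 0 (1 - n * infdist x C)\<close> equal 1 on \<open>C\<close> and
  tend to 0 off the closed set \<open>C\<close>; dominated convergence does the rest.\<close>

lemma closed_indicator_approximation:
  fixes X C :: "'a::metric_space set"
  assumes "compact X" "closed C" "C \<subseteq> X"
  obtains \<phi> :: "nat \<Rightarrow> 'a \<Rightarrow> real" where "\<And>n. continuous_on UNIV (\<phi> n)"
    "\<And>n x. indicator C x \<le> \<phi> n x"
    "\<And>M. M \<in> borel_prob_measures X \<Longrightarrow> (\<lambda>n. integral\<^sup>L M (\<phi> n)) \<longlonglongrightarrow> measure M C"
proof (cases "C = {}")
  \<comment> \<open>For empty \<open>C\<close> the general formula would give the constant 1, since
    \<open>infdist\<close> to the empty set is 0.\<close>
  case True
  then show thesis by (intro that[of "\<lambda>_ _. 0"]) auto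
next
  case False
  define \<phi> :: "nat \<Rightarrow> 'a \<Rightarrow> real" where "\<phi> n x = max 0 (1 - n * infdist x C)" for n x
  have c: "continuous_on UNIV (\<phi> n)" for n
    unfolding \<phi>_def by (intro continuous_intros)
  have 1: "indicator C x \<le> \<phi> n x" for n x
    by (auto simp: \<phi>_def indicator_def)
  have 2: "norm (\<phi> n x) \<le> 1" for n x
    by (auto simp: \<phi>_def infdist_nonneg)
  have lim: "(\<lambda>n. \<phi> n x) \<longlonglongrightarrow> indicator C x" for x
  proof (cases "x \<in> C")
    case True
    then show ?thesis by (simp add: \<phi>_def)
  next
    case x: False
    then have pos: "infdist x C > 0"
      using in_closed_iff_infdist_zero[OF assms(2) False] infdist_nonneg[of x C] by force
    obtain k :: nat where k: "1 / infdist x C < k"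
      using reals_Archimedean2 by blast
    have "\<phi> n x = 0" if "n \<ge> k" for n
    proof -
      have "1 / infdist x C \<le> n" using k that by linarith
      then show ?thesis using pos by (simp add: \<phi>_def field_simps)
    qed
    then show ?thesis
      using x by (auto intro!: tendsto_eventually eventually_sequentiallyI[of k])
  qed
  have "(\<lambda>n. integral\<^sup>L M (\<phi> n)) \<longlonglongrightarrow> measure M C" if M: "M \<in> borel_prob_measures X" for M
  proof -
    interpret prob_space M using borel_prob_measuresD[OF M] by simp
    have C: "C \<in> sets M"
      using assms sets_borel_prob_measure_closed[OF assms(1) M] by auto
    have "(\<lambda>n. integral\<^sup>L M (\<phi> n)) \<longlonglongrightarrow> integral\<^sup>L M (indicator C)"
      by (rule integral_dominated_convergence[where w="\<lambda>_. 1"])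
        (use lim 2 C borel_measurable_continuous[OF M continuous_on_subset[OF c subset_UNIV]] in auto)
    then show ?thesis using C by simp
  qed
  with c 1 show thesis by (rule that)
qed

text \<open>Inner approximation of \<open>B\<close> by closed sets is needed only for the measure on the left.\<close>

lemma dominated_on_sets:
  fixes X :: "'a::metric_space set" and N :: "'i \<Rightarrow> 'a measure"
  assumes X: "compact X" and M: "M \<in> borel_prob_measures X"
    and I: "finite I" and N: "\<And>i. i \<in> I \<Longrightarrow> N i \<in> borel_prob_measures X"
    and dom: "\<And>\<phi> :: 'a \<Rightarrow> real. continuous_on X \<phi> \<Longrightarrow> \<exists>i\<in>I. integral\<^sup>L M \<phi> \<le> integral\<^sup>L (N i) \<phi>"
    and B: "B \<in> sets M"
  shows "\<exists>i\<in>I. measure M B \<le> measure (N i) B"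
proof -
  interpret M: prob_space M using borel_prob_measuresD[OF M] by simp
  note setsM = sets_borel_prob_measure_closed[OF X M]
  have closed_case: "\<exists>i\<in>I. measure M C \<le> measure (N i) C" if C: "closed C" "C \<subseteq> X" for C
  proof (rule ccontr)
    assume "\<not> ?thesis"
    then have less: "\<And>i. i \<in> I \<Longrightarrow> measure (N i) C < measure M C" by force
    obtain \<phi> :: "nat \<Rightarrow> 'a \<Rightarrow> real" where \<phi>: "\<And>n. continuous_on UNIV (\<phi> n)"
      "\<And>n x. indicator C x \<le> \<phi> n x"
      "\<And>M. M \<in> borel_prob_measures X \<Longrightarrow> (\<lambda>n. integral\<^sup>L M (\<phi> n)) \<longlonglongrightarrow> measure M C"
      using closed_indicator_approximation[OF X C] by metis
    have cX: "continuous_on X (\<phi> n)" for n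
      using \<phi>(1) continuous_on_subset by blast
    have "\<forall>\<^sub>F n in sequentially. \<forall>i\<in>I. integral\<^sup>L (N i) (\<phi> n) < measure M C"
      using I less \<phi>(3)[OF N] by (intro eventually_ball_finite ballI order_tendstoD) auto
    from eventually_happens'[OF sequentially_bot this]
    obtain n where n: "\<And>i. i \<in> I \<Longrightarrow> integral\<^sup>L (N i) (\<phi> n) < measure M C"
      by blast
    have Cm: "C \<in> sets M" using C by (auto simp: setsM)
    have "measure M C = integral\<^sup>L M (indicator C)" using Cm by simp
    also have "\<dots> \<le> integral\<^sup>L M (\<phi> n)"
    proof (rule integral_mono[OF _ integrable_continuous[OF X M cX] \<phi>(2)])
      show "integrable M (indicator C :: 'a \<Rightarrow> real)"
        using Cm by (simp add: integrable_indicator_iff M.emeasure_eq_measure)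
    qed
    finally show False using dom[OF cX, of n] n by force
  qed
  show ?thesis
  proof (rule ccontr)
    assume "\<not> ?thesis"
    then have less: "\<And>i. i \<in> I \<Longrightarrow> measure (N i) B < measure M B" by force
    have "\<forall>\<^sub>F d in at_right 0. \<forall>i\<in>I. measure (N i) B < measure M B - d"
    proof (intro eventually_ball_finite I ballI)
      fix i assume "i \<in> I"
      show "\<forall>\<^sub>F d in at_right 0. measure (N i) B < measure M B - d"
        by (rule eventually_at_rightI[of 0 "measure M B - measure (N i) B"])
          (use less[OF \<open>i \<in> I\<close>] in auto)
    qed
    then have "\<forall>\<^sub>F d in at_right (0::real). (\<forall>i\<in>I. measure (N i) B < measure M B - d) \<and> d > 0"
      by (intro eventually_conj) (auto simp: eventually_at_right_less)
    then obtain d where d: "\<And>i. i \<in> I \<Longrightarrow> measure (N i) B < measure M B - d" "d > 0"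
      using eventually_happens[of _ "at_right (0::real)"] by force
    obtain C where C: "closed C" "C \<subseteq> B" "measure M B - d < measure M C"
      using closed_inner_regular[OF X M B d(2)] by blast
    have "C \<subseteq> X" using C(2) B by (auto simp: setsM)
    then obtain i where i: "i \<in> I" "measure M C \<le> measure (N i) C"
      using closed_case[OF C(1)] by blast
    interpret Ni: prob_space "N i" using borel_prob_measuresD[OF N[OF i(1)]] by simp
    have "B \<in> sets (N i)"
      using B borel_prob_measuresD(2)[OF M] borel_prob_measuresD(2)[OF N[OF i(1)]] by simp
    then have "measure (N i) C \<le> measure (N i) B"
      using C(2) by (rule Ni.finite_measure_mono[rotated])
    then show False using d(1)[OF i(1)] i(2) C(3) by linarith
  qed
qed

text \<open>Equal integrals are domination by a one-element family, and this holds in both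
  directions.\<close>

lemma borel_prob_measure_eqI:
  fixes X :: "'a::metric_space set"
  assumes X: "compact X" and M: "M \<in> borel_prob_measures X" and N: "N \<in> borel_prob_measures X"
    and eq: "\<And>\<phi> :: 'a \<Rightarrow> real. continuous_on X \<phi> \<Longrightarrow> integral\<^sup>L M \<phi> = integral\<^sup>L N \<phi>"
  shows "M = N"
proof (rule measure_eqI)
  interpret M: prob_space M using borel_prob_measuresD[OF M] by simp
  interpret N: prob_space N using borel_prob_measuresD[OF N] by simp
  show sets: "sets M = sets N"
    using borel_prob_measuresD(2)[OF M] borel_prob_measuresD(2)[OF N] by simp
  fix B assume B: "B \<in> sets M"
  have "measure M B \<le> measure N B" "measure N B \<le> measure M B"
    using dominated_on_sets[OF X M, of "{()}" "\<lambda>_. N" B] dominated_on_sets[OF X N, of "{()}" "\<lambda>_. M" B]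
      B sets eq M N by auto
  then show "emeasure M B = emeasure N B"
    by (simp add: M.emeasure_eq_measure N.emeasure_eq_measure)
qed


text \<open>The candidates \<open>\<phi> + t \<psi>\<close> fail for at most one \<open>t\<close> per pair.\<close>

lemma separating_continuous_function:
  fixes X :: "'a::metric_space set" and P :: "('a measure \<times> 'a measure) set"
  assumes X: "compact X" and P: "finite P"
    and distinct: "\<And>M N. (M, N) \<in> P \<Longrightarrow> M \<in> borel_prob_measures X \<and> N \<in> borel_prob_measures X \<and> M \<noteq> N"
  shows "\<exists>\<phi> :: 'a \<Rightarrow> real. continuous_on X \<phi> \<and> (\<forall>(M, N)\<in>P. integral\<^sup>L M \<phi> \<noteq> integral\<^sup>L N \<phi>)"
  using P distinct
proof (induction rule: finite_induct)
  case empty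
  show ?case by (intro exI[of _ "\<lambda>_. 0"]) auto
next
  case (insert Q P)
  obtain M N where Q: "Q = (M, N)" by (cases Q)
  have MN: "M \<in> borel_prob_measures X" "N \<in> borel_prob_measures X" "M \<noteq> N"
    using insert.prems[of M N] Q by auto
  obtain \<phi> :: "'a \<Rightarrow> real" where \<phi>: "continuous_on X \<phi>"
    "\<And>M N. (M, N) \<in> P \<Longrightarrow> integral\<^sup>L M \<phi> \<noteq> integral\<^sup>L N \<phi>"
    using insert.IH insert.prems by (force simp: case_prod_beta)
  obtain \<psi> :: "'a \<Rightarrow> real" where \<psi>: "continuous_on X \<psi>" "integral\<^sup>L M \<psi> \<noteq> integral\<^sup>L N \<psi>"
    using borel_prob_measure_eqI[OF X MN(1,2)] MN(3) by blast
  define D where "D \<eta> R = integral\<^sup>L (fst R) \<eta> - integral\<^sup>L (snd R) \<eta>"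
    for \<eta> :: "'a \<Rightarrow> real" and R :: "'a measure \<times> 'a measure"
  have D: "D (\<lambda>x. \<phi> x + t * \<psi> x) R = D \<phi> R + t * D \<psi> R" if R: "R \<in> insert Q P" for t R
  proof -
    have "fst R \<in> borel_prob_measures X" "snd R \<in> borel_prob_measures X"
      using insert.prems[of "fst R" "snd R"] R by auto
    then show ?thesis
      using integrable_continuous[OF X _ \<phi>(1)] integrable_continuous[OF X _ \<psi>(1)]
      by (simp add: D_def algebra_simps)
  qed
  obtain t where t: "t \<notin> (\<lambda>R. - D \<phi> R / D \<psi> R) ` insert Q P" "t \<noteq> 0"
  proof -
    have "\<exists>t::real. t \<notin> insert 0 ((\<lambda>R. - D \<phi> R / D \<psi> R) ` insert Q P)"
      using insert.hyps by (intro ex_new_if_finite infinite_UNIV_char_0) auto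
    then show thesis using that by auto
  qed
  have "D (\<lambda>x. \<phi> x + t * \<psi> x) R \<noteq> 0" if R: "R \<in> insert Q P" for R
  proof (cases "D \<psi> R = 0")
    case True
    \<comment> \<open>\<open>\<psi>\<close> separates the new pair \<open>Q\<close>, so a pair on
      which \<open>\<psi>\<close> fails belongs to \<open>P\<close>, where \<open>\<phi>\<close>
      already separates.\<close>
    then have "R \<in> P" using R \<psi>(2) by (auto simp: D_def Q)
    then have "D \<phi> R \<noteq> 0" using \<phi>(2)[of "fst R" "snd R"] by (simp add: D_def)
    then show ?thesis using D[OF R] True by simp
  next
    case False
    have "t \<noteq> - D \<phi> R / D \<psi> R" using t(1) R by blast
    then have "t * D \<psi> R \<noteq> - D \<phi> R" by (simp only: nonzero_eq_divide_eq[OF False] simp_thms)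
    then show ?thesis unfolding D[OF R] by linarith
  qed
  then have "\<forall>(M, N)\<in>insert Q P. integral\<^sup>L M (\<lambda>x. \<phi> x + t * \<psi> x) \<noteq> integral\<^sup>L N (\<lambda>x. \<phi> x + t * \<psi> x)"
    unfolding D_def case_prod_beta by simp
  moreover have "continuous_on X (\<lambda>x. \<phi> x + t * \<psi> x)"
    by (intro continuous_intros \<phi> \<psi>)
  ultimately show ?case
    by (intro exI[of _ "\<lambda>x. \<phi> x + t * \<psi> x"] conjI)
qed

section \<open>Empirical limits\<close>

definition orbit_average :: "('a \<Rightarrow> 'a) \<Rightarrow> ('a \<Rightarrow> real) \<Rightarrow> nat \<Rightarrow> 'a \<Rightarrow> real" where
  "orbit_average h \<phi> n x = (\<Sum>i<n. \<phi> ((h ^^ i) x)) / n"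

text \<open>These assumptions pass to iterates (\<open>iterate_selfmap\<close>), so every result
  below is available for \<open>f ^^ p\<close> as well as for \<open>f\<close>.\<close>

locale compact_selfmap =
  fixes X :: "'a::metric_space set" and f :: "'a \<Rightarrow> 'a"
  assumes compact: "compact X" and cont: "continuous_on X f" and self: "f ` X \<subseteq> X"
begin

lemma iterate_mem: "x \<in> X \<Longrightarrow> (f ^^ n) x \<in> X"
  by (induction n) (use self in auto)

lemma iterate_continuous: "continuous_on X (f ^^ n)"
proof (induction n)
  case (Suc n)
  have "continuous_on X (\<lambda>x. f ((f ^^ n) x))"
    by (rule continuous_on_compose2[OF cont Suc]) (auto intro: iterate_mem)
  then show ?case by (simp add: comp_def)
qed (simp add: continuous_on_id)

lemma continuous_comp_iterate:
  "continuous_on X \<phi> \<Longrightarrow> continuous_on X (\<lambda>x. \<phi> ((f ^^ n) x))"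
  by (rule continuous_on_compose2[OF _ iterate_continuous]) (auto intro: iterate_mem)

lemma iterate_selfmap: "compact_selfmap X (f ^^ n)"
  by unfold_locales (auto intro: compact iterate_continuous iterate_mem)

lemma iterate_measurable:
  assumes "M \<in> borel_prob_measures X"
  shows "(f ^^ n) \<in> measurable M (restrict_space borel X)"
  by (intro measurable_restrict_space2 borel_measurable_continuous[OF assms iterate_continuous])
    (auto simp: borel_prob_measuresD(3)[OF assms] iterate_mem)

section \<open>Push-forwards of measures along the iterates\<close>

definition push :: "'a measure \<Rightarrow> nat \<Rightarrow> 'a measure" where
  "push M n = distr M (restrict_space borel X) (f ^^ n)"

lemma push_borel_prob:
  assumes "M \<in> borel_prob_measures X"
  shows "push M n \<in> borel_prob_measures X"
  using prob_space.prob_space_distr[OF borel_prob_measuresD(1)[OF assms] iterate_measurable[OF assms]]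
  by (simp add: borel_prob_measures_def push_def)

lemma integral_push:
  fixes \<phi> :: "'a \<Rightarrow> real"
  assumes "M \<in> borel_prob_measures X" "continuous_on X \<phi>"
  shows "integral\<^sup>L (push M n) \<phi> = (\<integral>x. \<phi> ((f ^^ n) x) \<partial>M)"
  unfolding push_def
  by (rule integral_distr[OF iterate_measurable[OF assms(1)]
        borel_measurable_continuous_on_restrict[OF assms(2)]])

lemma emeasure_push:
  assumes "M \<in> borel_prob_measures X" "B \<in> sets M"
  shows "emeasure (push M n) B = emeasure M ((f ^^ n) -` B \<inter> X)"
  unfolding push_def using assms borel_prob_measuresD[OF assms(1)]
  by (subst emeasure_distr[OF iterate_measurable[OF assms(1)]]) auto

lemma sets_push [simp]: "M \<in> borel_prob_measures X \<Longrightarrow> sets (push M n) = sets M"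
  by (simp add: push_def borel_prob_measuresD(2))

lemma push_0:
  assumes "M \<in> borel_prob_measures X"
  shows "push M 0 = M"
  by (rule borel_prob_measure_eqI[OF compact push_borel_prob[OF assms] assms])
    (simp add: integral_push[OF assms])

lemma push_push:
  assumes "M \<in> borel_prob_measures X"
  shows "push (push M m) n = push M (m + n)"
  by (rule borel_prob_measure_eqI[OF compact])
    (simp_all add: push_borel_prob assms integral_push continuous_comp_iterate funpow_add add.commute[of m])

lemma invariant_iff_push:
  "M \<in> invariant_measures X (f ^^ p) \<longleftrightarrow> M \<in> borel_prob_measures X \<and> push M p = M"
proof (intro iffI conjI)
  assume "M \<in> invariant_measures X (f ^^ p)"
  then have M: "M \<in> borel_prob_measures X"
    and inv: "\<And>B. B \<in> sets M \<Longrightarrow> emeasure M ((f ^^ p) -` B \<inter> X) = emeasure M B"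
    by (auto simp: invariant_measures_def)
  show "M \<in> borel_prob_measures X" by fact
  show "push M p = M"
    by (rule measure_eqI) (auto simp: M emeasure_push[OF M] inv)
next
  assume "M \<in> borel_prob_measures X \<and> push M p = M"
  then show "M \<in> invariant_measures X (f ^^ p)"
    unfolding invariant_measures_def using emeasure_push[of M _ p] by auto
qed

lemma invariant_push:
  assumes "M \<in> invariant_measures X (f ^^ p)"
  shows "push M n \<in> invariant_measures X (f ^^ p)"
proof -
  have M: "M \<in> borel_prob_measures X" "push M p = M"
    using assms by (auto simp: invariant_iff_push)
  have "push (push M n) p = push (push M p) n"
    unfolding push_push[OF M(1)] by (simp only: add.commute)
  also have "\<dots> = push M n" by (simp only: M(2))
  finally have "push (push M n) p = push M n" .
  then show ?thesis
    by (intro invariant_iff_push[THEN iffD2] conjI push_borel_prob M(1))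
qed

text \<open>Going \<open>p\<close> steps returns to \<open>M\<close>. For positive \<open>p\<close>,
  an \<open>f ^^ p\<close>-invariant measure therefore has only finitely many translates.\<close>

lemma push_mod:
  assumes "M \<in> invariant_measures X (f ^^ p)"
  shows "push M (n mod p) = push M n"
proof -
  have M: "M \<in> borel_prob_measures X" "push M p = M"
    using assms by (auto simp: invariant_iff_push)
  have "push M (p * k) = M" for k
  proof (induction k)
    case (Suc k)
    have "push M (p * Suc k) = push (push M (p * k)) p"
      by (simp add: push_push M(1) add.commute)
    also have "\<dots> = M" by (simp only: Suc M(2))
    finally show ?case .
  qed (simp add: push_0 M(1))
  then have "push (push M (p * (n div p))) (n mod p) = push M (n mod p)" by (simp only:)
  then show ?thesis by (simp add: push_push M(1))
qed

section \<open>Empirical measures and their accumulation points\<close>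

lemma integral_empirical_measure:
  fixes \<phi> :: "'a \<Rightarrow> real"
  assumes "x \<in> X" "continuous_on X \<phi>"
  shows "integral\<^sup>L (empirical_measure X f n x) \<phi> = orbit_average f \<phi> n x"
proof -
  have "(\<lambda>i. (f ^^ i) x) \<in> measurable (uniform_count_measure {..<n}) (restrict_space borel X)"
    using iterate_mem[OF assms(1)]
    by (auto simp: measurable_def space_uniform_count_measure sets_uniform_count_measure space_restrict_space)
  then show ?thesis
    unfolding empirical_measure_def orbit_average_def
    by (subst integral_distr[OF _ borel_measurable_continuous_on_restrict[OF assms(2)]])
      (simp_all add: integral_uniform_count_measure)
qed

lemma empirical_measure_borel_prob:
  assumes "x \<in> X" "n > 0"
  shows "empirical_measure X f n x \<in> borel_prob_measures X"
proof -
  have "(\<lambda>i. (f ^^ i) x) \<in> measurable (uniform_count_measure {..<n}) (restrict_space borel X)"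
    using iterate_mem[OF assms(1)]
    by (auto simp: measurable_def space_uniform_count_measure sets_uniform_count_measure space_restrict_space)
  moreover have "prob_space (uniform_count_measure {..<n})"
    using assms(2) by (intro prob_space_uniform_count_measure) auto
  ultimately show ?thesis
    by (simp add: borel_prob_measures_def empirical_measure_def prob_space.prob_space_distr)
qed

text \<open>Sequential compactness along the times \<open>s k\<close> yields \<open>M\<close> with
  convergent integrals. This is turned into accumulation in the weak-star topology, so that limits
  can be produced along any prescribed unbounded sequence of times.\<close>

lemma empirical_limits_cluster:
  assumes x: "x \<in> X" and s: "\<And>k. s k > k"
  obtains r M where "strict_mono (r :: nat \<Rightarrow> nat)" "M \<in> empirical_limits X f x"
    "\<And>\<phi>. continuous_on X \<phi> \<Longrightarrow> (\<lambda>k. orbit_average f \<phi> (s (r k)) x) \<longlonglongrightarrow> integral\<^sup>L M \<phi>"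
proof -
  have s0: "s k > 0" for k using s[of k] by simp
  obtain r M where r: "strict_mono (r :: nat \<Rightarrow> nat)" and M: "M \<in> borel_prob_measures X"
    and "\<And>\<phi> :: 'a \<Rightarrow> real. continuous_on X \<phi> \<Longrightarrow>
       (\<lambda>k. (\<Sum>i<s (r k). \<phi> ((f ^^ i) x)) / s (r k)) \<longlonglongrightarrow> integral\<^sup>L M \<phi>"
    using weak_star_sequential_compactness[OF compact iterate_mem[OF x], of s "\<lambda>_ i. i"] s0 by blast
  then have lim: "\<And>\<phi>. continuous_on X \<phi> \<Longrightarrow> (\<lambda>k. orbit_average f \<phi> (s (r k)) x) \<longlonglongrightarrow> integral\<^sup>L M \<phi>"
    by (simp add: orbit_average_def)
  \<comment> \<open>The selected times exceed \<open>k\<close>, so membership for all large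
    \<open>k\<close> gives membership for arbitrarily large times.\<close>
  have sr: "s (r k) > k" for k
    using s[of "r k"] seq_suble[OF r, of k] by simp
  define S where "S = {{M \<in> borel_prob_measures X. integral\<^sup>L M \<phi> \<in> U} |(\<phi> :: 'a \<Rightarrow> real) U.
        continuous_on X \<phi> \<and> open U}"
  \<comment> \<open>Containing the empirical measures eventually is inherited by finite
    intersections and by unions, so it suffices to check the generating sets, where it is
    convergence of one integral.\<close>
  have ev: "\<forall>\<^sub>F k in sequentially. empirical_measure X f (s (r k)) x \<in> U"
    if "generate_topology_on S U" "M \<in> U" for U
    using that
  proof induction
    case (Int a b)
    then show ?case by (auto intro: eventually_conj)
  next
    case (UN K)
    then obtain k where "k \<in> K" "M \<in> k" by blast
    then show ?case using UN.IH[of k] by (auto elim!: eventually_mono)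
  next
    case (Basis U)
    then obtain \<phi> :: "'a \<Rightarrow> real" and V where U: "U = {M \<in> borel_prob_measures X. integral\<^sup>L M \<phi> \<in> V}"
      and \<phi>: "continuous_on X \<phi>" and V: "open V"
      unfolding S_def by blast
    have "\<forall>\<^sub>F k in sequentially. orbit_average f \<phi> (s (r k)) x \<in> V"
      using topological_tendstoD[OF lim[OF \<phi>] V] Basis.prems U by simp
    then show ?case
      by eventually_elim
        (use s0 in \<open>simp add: U integral_empirical_measure[OF x \<phi>] empirical_measure_borel_prob[OF x]\<close>)
  qed simp
  have "M \<in> empirical_limits X f x"
    unfolding empirical_limits_def
  proof (intro CollectI conjI M allI impI)
    fix U assume U: "openin (weak_star_topology X) U \<and> M \<in> U"
    then have "generate_topology_on S U"
      by (simp add: weak_star_topology_def S_def openin_topology_generated_by_iff)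
    then have "\<forall>\<^sub>F k in sequentially. empirical_measure X f (s (r k)) x \<in> U"
      using ev U by blast
    then obtain k0 where k0: "\<And>k. k \<ge> k0 \<Longrightarrow> empirical_measure X f (s (r k)) x \<in> U"
      by (auto simp: eventually_sequentially)
    show "\<exists>\<^sub>F n in sequentially. empirical_measure X f n x \<in> U"
      unfolding frequently_sequentially
    proof
      fix n
      show "\<exists>m\<ge>n. empirical_measure X f m x \<in> U"
        using k0[of "max k0 n"] sr[of "max k0 n"] by (intro exI[of _ "s (r (max k0 n))"]) auto
    qed
  qed
  from that[OF r this lim] show thesis .
qed

lemma empirical_limits_nonempty:
  assumes "x \<in> X"
  obtains M where "M \<in> empirical_limits X f x"
  using empirical_limits_cluster[OF assms, of Suc] by blast

text \<open>Finitely many test functions cut out one neighbourhood of \<open>M\<close>, so a single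
  time \<open>n\<close> serves all of them at once.\<close>

lemma empirical_limits_frequently:
  fixes \<Phi> :: "('a \<Rightarrow> real) set"
  assumes x: "x \<in> X" and M: "M \<in> empirical_limits X f x"
    and \<Phi>: "finite \<Phi>" "\<And>\<phi>. \<phi> \<in> \<Phi> \<Longrightarrow> continuous_on X \<phi>" and "e > 0"
  shows "\<exists>\<^sub>F n in sequentially. \<forall>\<phi>\<in>\<Phi>. \<bar>orbit_average f \<phi> n x - integral\<^sup>L M \<phi>\<bar> < e"
proof -
  define W where "W \<phi> = {N \<in> borel_prob_measures X. integral\<^sup>L N \<phi> \<in> ball (integral\<^sup>L M \<phi>) e}" for \<phi> :: "'a \<Rightarrow> real"
  have W: "openin (weak_star_topology X) (W \<phi>)" if "continuous_on X \<phi>" for \<phi>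
    unfolding W_def weak_star_topology_def
    by (rule topology_generated_by_Basis, rule CollectI, rule exI[of _ \<phi>],
        rule exI[of _ "ball (integral\<^sup>L M \<phi>) e"]) (simp add: that)
  have Mb: "M \<in> borel_prob_measures X"
    using M by (simp add: empirical_limits_def)
  \<comment> \<open>The zero function is inserted so that the intersection is taken over a nonempty
    finite family; its own condition only says that the measure is a Borel probability on
    \<open>X\<close>.\<close>
  have "openin (weak_star_topology X) (\<Inter>\<phi>\<in>insert (\<lambda>_. 0) \<Phi>. W \<phi>)"
    using \<Phi> W by (intro openin_INT2) auto
  moreover have "M \<in> (\<Inter>\<phi>\<in>insert (\<lambda>_. 0) \<Phi>. W \<phi>)"
    using Mb \<open>e > 0\<close> by (auto simp: W_def)
  ultimately have "\<exists>\<^sub>F n in sequentially. empirical_measure X f n x \<in> (\<Inter>\<phi>\<in>insert (\<lambda>_. 0) \<Phi>. W \<phi>)"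
    using M unfolding empirical_limits_def by blast
  then show ?thesis
  proof (rule frequently_elim1, intro ballI)
    fix n \<phi> assume "empirical_measure X f n x \<in> (\<Inter>\<phi>\<in>insert (\<lambda>_. 0) \<Phi>. W \<phi>)" "\<phi> \<in> \<Phi>"
    then have "integral\<^sup>L (empirical_measure X f n x) \<phi> \<in> ball (integral\<^sup>L M \<phi>) e"
      by (auto simp: W_def)
    then show "\<bar>orbit_average f \<phi> n x - integral\<^sup>L M \<phi>\<bar> < e"
      using \<Phi>(2)[OF \<open>\<phi> \<in> \<Phi>\<close>] by (simp add: integral_empirical_measure[OF x] dist_real_def abs_minus_commute)
  qed
qed

lemma orbit_average_shift:
  assumes "x \<in> X" "\<And>y. y \<in> X \<Longrightarrow> \<bar>\<phi> y\<bar> \<le> B"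
  shows "\<bar>orbit_average f (\<lambda>y. \<phi> (f y)) n x - orbit_average f \<phi> n x\<bar> \<le> 2 * B / n"
proof -
  have "(\<Sum>i<n. \<phi> (f ((f ^^ i) x))) - (\<Sum>i<n. \<phi> ((f ^^ i) x)) = \<phi> ((f ^^ n) x) - \<phi> x"
    using sum_lessThan_telescope[of "\<lambda>i. \<phi> ((f ^^ i) x)" n] by (simp add: sum_subtractf)
  moreover have "\<bar>\<phi> ((f ^^ n) x) - \<phi> x\<bar> \<le> 2 * B"
    using assms(2)[OF assms(1)] assms(2)[OF iterate_mem[OF assms(1), of n]] by linarith
  ultimately show ?thesis
    unfolding orbit_average_def diff_divide_distrib[symmetric]
    by (simp add: divide_right_mono)
qed

text \<open>The averages of \<open>\<phi>\<close> and of \<open>\<phi> \<circ> f\<close> differ by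
  \<open>O(1/n)\<close>. At a common large time each is within \<open>e / 3\<close> of its integral
  and the shift error is below \<open>e / 3\<close>, so the two integrals agree.\<close>

lemma empirical_limits_invariant:
  assumes x: "x \<in> X" and M: "M \<in> empirical_limits X f x"
  shows "M \<in> invariant_measures X f"
proof -
  have Mb: "M \<in> borel_prob_measures X"
    using M by (simp add: empirical_limits_def)
  have "integral\<^sup>L (push M 1) \<phi> = integral\<^sup>L M \<phi>" if \<phi>: "continuous_on X \<phi>" for \<phi> :: "'a \<Rightarrow> real"
  proof -
    obtain B where B: "B > 0" "\<And>x. x \<in> X \<Longrightarrow> \<bar>\<phi> x\<bar> \<le> B"
      using continuous_bounded_on_compact[OF compact \<phi>] by metis
    have \<phi>f: "continuous_on X (\<lambda>y. \<phi> (f y))"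
      using continuous_comp_iterate[OF \<phi>, of 1] by simp
    have "\<bar>(\<integral>x. \<phi> (f x) \<partial>M) - integral\<^sup>L M \<phi>\<bar> \<le> e" if "e > 0" for e
    proof -
      have "\<exists>\<^sub>F n in sequentially. \<forall>\<psi>\<in>{\<phi>, \<lambda>y. \<phi> (f y)}. \<bar>orbit_average f \<psi> n x - integral\<^sup>L M \<psi>\<bar> < e / 3"
        using \<phi> \<phi>f \<open>e > 0\<close> by (intro empirical_limits_frequently[OF x M]) auto
      moreover have "(\<lambda>n. 2 * B / real n) \<longlonglongrightarrow> 0"
        by (rule lim_const_over_n)
      then have "\<forall>\<^sub>F n in sequentially. 2 * B / real n < e / 3"
        using \<open>e > 0\<close> by (intro order_tendstoD) auto
      ultimately have "\<exists>\<^sub>F n in sequentially.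
          (\<forall>\<psi>\<in>{\<phi>, \<lambda>y. \<phi> (f y)}. \<bar>orbit_average f \<psi> n x - integral\<^sup>L M \<psi>\<bar> < e / 3) \<and> 2 * B / real n < e / 3"
        by (rule frequently_eventually_frequently)
      then obtain n where n: "\<bar>orbit_average f \<phi> n x - integral\<^sup>L M \<phi>\<bar> < e / 3"
        "\<bar>orbit_average f (\<lambda>y. \<phi> (f y)) n x - (\<integral>x. \<phi> (f x) \<partial>M)\<bar> < e / 3" "2 * B / real n < e / 3"
        using frequently_ex by force
      then show ?thesis
        using orbit_average_shift[where \<phi>=\<phi> and B=B and n=n, OF x B(2)] by linarith
    qed
    then have "\<bar>(\<integral>x. \<phi> (f x) \<partial>M) - integral\<^sup>L M \<phi>\<bar> \<le> 0"
      by (rule field_le_epsilon) simp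
    then show ?thesis by (simp add: integral_push[OF Mb \<phi>])
  qed
  then have "push M 1 = M"
    by (intro borel_prob_measure_eqI[OF compact push_borel_prob Mb] Mb)
  then show ?thesis
    using invariant_iff_push[of M 1] Mb by simp
qed

text \<open>Consecutive orbit averages get arbitrarily close, so the limit values of an orbit average
  fill an interval.\<close>

lemma finite_empirical_limits_unique:
  assumes x: "x \<in> X" and fin: "finite (empirical_limits X f x)"
    and MN: "M \<in> empirical_limits X f x" "N \<in> empirical_limits X f x"
  shows "M = N"
proof (rule ccontr)
  assume "M \<noteq> N"
  then obtain \<psi> :: "'a \<Rightarrow> real" where \<psi>: "continuous_on X \<psi>" "integral\<^sup>L M \<psi> \<noteq> integral\<^sup>L N \<psi>"
    using borel_prob_measure_eqI[OF compact, of M N] MN by (auto simp: empirical_limits_def)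
  obtain \<phi> :: "'a \<Rightarrow> real" where \<phi>: "continuous_on X \<phi>" and less: "integral\<^sup>L M \<phi> < integral\<^sup>L N \<phi>"
  proof (cases "integral\<^sup>L M \<psi> < integral\<^sup>L N \<psi>")
    case True
    with \<psi>(1) show thesis by (rule that)
  next
    case False
    then show thesis
      using \<psi> by (intro that[of "\<lambda>x. - \<psi> x"] continuous_intros) auto
  qed
  \<comment> \<open>Finitely many limits give finitely many integrals, so some value strictly
    between the two given ones is missed by all limits.\<close>
  obtain t where t: "integral\<^sup>L M \<phi> < t" "t < integral\<^sup>L N \<phi>"
    "t \<notin> (\<lambda>M. integral\<^sup>L M \<phi>) ` empirical_limits X f x"
  proof -
    have "infinite ({integral\<^sup>L M \<phi> <..< integral\<^sup>L N \<phi>} - (\<lambda>M. integral\<^sup>L M \<phi>) ` empirical_limits X f x)"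
      using less fin by (intro Diff_infinite_finite infinite_Ioo) auto
    then have "{integral\<^sup>L M \<phi> <..< integral\<^sup>L N \<phi>} - (\<lambda>M. integral\<^sup>L M \<phi>) ` empirical_limits X f x \<noteq> {}"
      by (metis finite.emptyI)
    then obtain t where "t \<in> {integral\<^sup>L M \<phi> <..< integral\<^sup>L N \<phi>} - (\<lambda>M. integral\<^sup>L M \<phi>) ` empirical_limits X f x"
      by blast
    then show thesis by (intro that[of t]) auto
  qed
  obtain B where B: "B > 0" "\<And>x. x \<in> X \<Longrightarrow> \<bar>\<phi> x\<bar> \<le> B"
    using continuous_bounded_on_compact[OF compact \<phi>] by metis
  define a where "a n = orbit_average f \<phi> n x" for n
  have step: "\<bar>a (Suc n) - a n\<bar> \<le> 2 * B / Suc n" if "n > 0" for n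
  proof -
    have "\<bar>\<Sum>i<n. \<phi> ((f ^^ i) x)\<bar> \<le> (\<Sum>i<n. B)"
      by (rule order_trans[OF sum_abs]) (intro sum_mono B iterate_mem x)
    then have 1: "\<bar>a n\<bar> \<le> B"
      using \<open>n > 0\<close> by (simp add: a_def orbit_average_def field_simps)
    have "a (Suc n) * Suc n = a n * n + \<phi> ((f ^^ n) x)"
      using \<open>n > 0\<close> by (simp add: a_def orbit_average_def)
    then have "(a (Suc n) - a n) * Suc n = \<phi> ((f ^^ n) x) - a n"
      by (simp add: algebra_simps)
    moreover have "\<bar>\<phi> ((f ^^ n) x) - a n\<bar> \<le> 2 * B"
      using 1 B(2)[OF iterate_mem[OF x, of n]] by linarith
    ultimately have "\<bar>a (Suc n) - a n\<bar> * Suc n \<le> 2 * B"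
      by (metis abs_mult abs_of_nat)
    then show ?thesis by (simp add: field_simps)
  qed
  have close: "\<exists>n>k. \<bar>a n - t\<bar> < 1 / Suc k" for k :: nat
  proof -
    have "(\<lambda>n. 2 * B / real n) \<longlonglongrightarrow> 0"
      by (rule lim_const_over_n)
    then have "\<forall>\<^sub>F n in sequentially. 2 * B / real n < 1 / Suc k"
      by (intro order_tendstoD) auto
    then obtain n0 where n0: "\<And>n. n \<ge> n0 \<Longrightarrow> 2 * B / real n < 1 / Suc k"
      by (auto simp: eventually_sequentially)
    have "\<exists>\<^sub>F n in sequentially. \<forall>\<psi>\<in>{\<phi>}. \<bar>orbit_average f \<psi> n x - integral\<^sup>L M \<psi>\<bar> < t - integral\<^sup>L M \<phi>"
      using \<phi> t by (intro empirical_limits_frequently[OF x MN(1)]) auto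
    then obtain n1 where n1: "n1 \<ge> max n0 (Suc k)" "\<bar>a n1 - integral\<^sup>L M \<phi>\<bar> < t - integral\<^sup>L M \<phi>"
      unfolding frequently_sequentially a_def by blast
    then have an1: "a n1 < t" by linarith
    have "\<exists>\<^sub>F n in sequentially. \<forall>\<psi>\<in>{\<phi>}. \<bar>orbit_average f \<psi> n x - integral\<^sup>L N \<psi>\<bar> < integral\<^sup>L N \<phi> - t"
      using \<phi> t by (intro empirical_limits_frequently[OF x MN(2)]) auto
    then obtain n2 where n2: "n2 \<ge> n1" "\<bar>a n2 - integral\<^sup>L N \<phi>\<bar> < integral\<^sup>L N \<phi> - t"
      unfolding frequently_sequentially a_def by blast
    then have an2: "t \<le> a n2" by linarith
    \<comment> \<open>The first time from \<open>n1\<close> on at which the average reaches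
      \<open>t\<close>: the average just before is below \<open>t\<close>, so both are within one
      step size of \<open>t\<close>.\<close>
    define n where "n = (LEAST n. n1 \<le> n \<and> t \<le> a n)"
    have n: "n1 \<le> n" "t \<le> a n"
      using LeastI[of "\<lambda>n. n1 \<le> n \<and> t \<le> a n" n2] n2(1) an2 by (auto simp: n_def)
    with an1 have "n1 < n" by (cases "n = n1") auto
    then obtain m where m: "n = Suc m" "n1 \<le> m" by (cases n) auto
    have "a m < t"
      using not_less_Least[of m "\<lambda>n. n1 \<le> n \<and> t \<le> a n"] m by (auto simp: n_def)
    moreover have "\<bar>a (Suc m) - a m\<bar> \<le> 2 * B / Suc m"
      using step[of m] n1 m by auto
    moreover have "2 * B / Suc m < 1 / Suc k"
      using n0[of "Suc m"] n1 m by auto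
    ultimately have "\<bar>a n - t\<bar> < 1 / Suc k"
      using n(2) unfolding m(1) by linarith
    moreover have "n > k" using n(1) n1(1) by linarith
    ultimately show ?thesis by blast
  qed
  then obtain s where s: "\<And>k. s k > k" "\<And>k. \<bar>a (s k) - t\<bar> < 1 / Suc k"
    by metis
  \<comment> \<open>A limit along these crossing times has integral exactly \<open>t\<close>, a
    value chosen to be missed.\<close>
  obtain r L where r: "strict_mono (r :: nat \<Rightarrow> nat)" and L: "L \<in> empirical_limits X f x"
    and lim: "\<And>\<phi>. continuous_on X \<phi> \<Longrightarrow> (\<lambda>k. orbit_average f \<phi> (s (r k)) x) \<longlonglongrightarrow> integral\<^sup>L L \<phi>"
    using empirical_limits_cluster[OF x s(1)] by metis
  have "(\<lambda>k. a (s k)) \<longlonglongrightarrow> t"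
  proof (rule LIM_zero_cancel, rule Lim_null_comparison)
    show "\<forall>\<^sub>F k in sequentially. norm (a (s k) - t) \<le> 1 / real (Suc k)"
      using s(2) by (auto intro!: always_eventually less_imp_le)
    show "(\<lambda>k. 1 / real (Suc k)) \<longlonglongrightarrow> 0"
      using LIMSEQ_inverse_real_of_nat by (simp add: inverse_eq_divide)
  qed
  from LIMSEQ_subseq_LIMSEQ[OF this r] have "integral\<^sup>L L \<phi> = t"
    using LIMSEQ_unique lim[OF \<phi>] by (auto simp: a_def comp_def)
  then show False using t(3) L by blast
qed

section \<open>Dominating limits are ergodic and generic\<close>

text \<open>The index \<open>i\<close> may depend on \<open>\<phi>\<close>. For positive
  \<open>p\<close> and Borel probabilities on compact \<open>X\<close>, separation of convex sets
  shows that this says that \<open>N\<close> is a convex combination of the translates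
  \<open>push M i\<close>.\<close>

definition dominates :: "nat \<Rightarrow> 'a measure \<Rightarrow> 'a measure \<Rightarrow> bool" where
  "dominates p M N \<longleftrightarrow>
     (\<forall>\<phi> :: 'a \<Rightarrow> real. continuous_on X \<phi> \<longrightarrow> (\<exists>i<p. integral\<^sup>L N \<phi> \<le> integral\<^sup>L (push M i) \<phi>))"

text \<open>Conditioning \<open>M\<close> on \<open>D\<close>, the intersection of \<open>B\<close> with all its full-measure preimages,
  gives an invariant measure; dominating it forces some preimage of \<open>D\<close> to have full measure.
  Hence the full-measure times are closed under adding some fixed time \<open>i\<close>, and so contain
  the period \<open>p * i\<close>.\<close>

lemma dominating_imp_ergodic:
  assumes p: "p > 0" and M: "M \<in> invariant_measures X (f ^^ p)"
    and dom: "\<And>N. N \<in> invariant_measures X (f ^^ p) \<Longrightarrow> dominates p M N"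
  shows "M \<in> ergodic_measures X (f ^^ p)"
proof -
  have Mb: "M \<in> borel_prob_measures X"
    and inv: "\<And>B. B \<in> sets M \<Longrightarrow> emeasure M ((f ^^ p) -` B \<inter> X) = emeasure M B"
    using M by (auto simp: invariant_measures_def)
  interpret prob_space M using borel_prob_measuresD[OF Mb] by simp
  have sp: "space M = X" using borel_prob_measuresD[OF Mb] by simp
  have pre: "(f ^^ n) -` B \<inter> X \<in> sets M" if "B \<in> sets M" for n B
    using measurable_sets[OF iterate_measurable[OF Mb], of B n] that
    by (simp add: sp borel_prob_measuresD(2)[OF Mb])
  have "emeasure M B = 1" if B: "B \<in> sets M" and Binv: "(f ^^ p) -` B \<inter> X = B" and pos: "emeasure M B \<noteq> 0" for B
  proof -
    define T where "T k = (f ^^ k) -` B \<inter> X" for k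
    have BX: "B \<subseteq> X" using sets.sets_into_space[OF B] by (simp add: sp)
    have T: "T k \<in> sets M" for k
      unfolding T_def by (rule pre[OF B])
    have T_pre: "(f ^^ i) -` T k \<inter> X = T (k + i)" for i k
      unfolding T_def using iterate_mem by (auto simp: funpow_add)
    have T0: "T 0 = B" using BX by (auto simp: T_def)
    have "T p = B" using Binv by (simp add: T_def)
    have T_period: "T (k + p) = T k" for k
    proof -
      have "T (p + k) = (f ^^ k) -` T p \<inter> X" "T (0 + k) = (f ^^ k) -` T 0 \<inter> X"
        by (simp_all only: T_pre)
      then show ?thesis by (simp add: T0 \<open>T p = B\<close> add.commute)
    qed
    define S where "S = {k. measure M (T k) = 1}"
    define D where "D = B \<inter> (\<Inter>k\<in>S. T k)"
    have D_eq: "D = {x \<in> space M. x \<in> B \<and> (\<forall>k\<in>S. x \<in> T k)}"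
      using BX by (auto simp: D_def sp)
    have D: "D \<in> sets M"
      unfolding D_eq using B T by measurable
    have AE_T: "AE x in M. x \<in> T k" if "k \<in> S" for k
      using that prob_eq_1[OF T] by (simp add: S_def)
    \<comment> \<open>Only countably many null sets are removed from \<open>B\<close>, so
      \<open>D\<close> keeps its positive measure and can be conditioned on.\<close>
    have "AE x in M. \<forall>k\<in>S. x \<in> T k"
      by (subst AE_ball_countable) (use AE_T in auto)
    then have "AE x in M. x \<in> D \<longleftrightarrow> x \<in> B"
      by eventually_elim (auto simp: D_def)
    then have "emeasure M D = emeasure M B"
      by (rule emeasure_eq_AE) (use D B in auto)
    then have D_pos: "emeasure M D \<noteq> 0" using pos by simp
    have D_fin: "emeasure M D \<noteq> \<infinity>" by simp
    have D_pre: "(f ^^ i) -` D \<inter> X = T i \<inter> (\<Inter>k\<in>S. T (k + i)) \<inter> X" for i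
      unfolding D_def T_pre[symmetric] by (auto simp: T_def)
    have D_inv: "(f ^^ p) -` D \<inter> X = D"
      unfolding D_pre T_period using \<open>T p = B\<close> BX by (auto simp: D_def)
    define N where "N = uniform_measure M D"
    have Nb: "N \<in> borel_prob_measures X"
      unfolding borel_prob_measures_def N_def
      using prob_space_uniform_measure[OF D_pos D_fin] borel_prob_measuresD(2)[OF Mb] by simp
    have "emeasure N ((f ^^ p) -` C \<inter> X) = emeasure N C" if "C \<in> sets M" for C
    proof -
      have "D \<inter> ((f ^^ p) -` C \<inter> X) = (f ^^ p) -` (D \<inter> C) \<inter> X"
        using D_inv by blast
      then have "emeasure M (D \<inter> ((f ^^ p) -` C \<inter> X)) = emeasure M (D \<inter> C)"
        using inv[of "D \<inter> C"] D that by simp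
      then show ?thesis
        unfolding N_def by (simp add: emeasure_uniform_measure[OF D] pre[OF that] that)
    qed
    then have "N \<in> invariant_measures X (f ^^ p)"
      using Nb by (simp add: invariant_measures_def N_def)
    then have "dominates p M N" by (rule dom)
    \<comment> \<open>\<open>N\<close> gives \<open>D\<close> mass 1. Domination passes from
      continuous functions to this set, so some preimage of \<open>D\<close> has full measure under
      \<open>M\<close>.\<close>
    then have "\<exists>i\<in>{..<p}. measure N D \<le> measure (push M i) D"
      using D by (intro dominated_on_sets[OF compact Nb])
        (auto simp: dominates_def push_borel_prob[OF Mb] N_def)
    then obtain i where i: "measure N D \<le> measure (push M i) D" by blast
    have "measure N D = 1"
      using emeasure_uniform_measure_1[OF D_pos D_fin] by (simp add: N_def measure_def)
    moreover have "measure (push M i) D = measure M ((f ^^ i) -` D \<inter> X)"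
      using emeasure_push[OF Mb D] by (simp add: measure_def)
    ultimately have full: "1 \<le> measure M ((f ^^ i) -` D \<inter> X)" using i by simp
    have full_T: "k \<in> S" if "(f ^^ i) -` D \<inter> X \<subseteq> T k" for k
    proof -
      have "1 \<le> measure M (T k)"
        using full finite_measure_mono[OF that T] by linarith
      then show ?thesis
        using prob_le_1[of "T k"] by (simp add: S_def)
    qed
    \<comment> \<open>The preimage of \<open>D\<close> under \<open>f ^^ i\<close> lies in
      \<open>T i\<close>, and also in \<open>T (k + i)\<close> for every \<open>k \<in> S\<close>;
      being of full measure, it puts these times into \<open>S\<close>.\<close>
    have S_i: "i \<in> S"
      by (rule full_T) (use D_pre in auto)
    have S_add: "k + i \<in> S" if "k \<in> S" for k
      by (rule full_T) (use D_pre that in auto)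
    have "Suc j * i \<in> S" for j
    proof (induction j)
      case (Suc j)
      then show ?case using S_add[of "Suc j * i"] by (simp add: algebra_simps)
    qed (use S_i in simp)
    \<comment> \<open>With \<open>j = p - 1\<close> the time is \<open>p * i\<close>, a multiple of
      the period of \<open>T\<close>, so \<open>T (p * i)\<close> is \<open>B\<close>
      itself.\<close>
    from this[of "p - 1"] have "p * i \<in> S" using p by simp
    moreover have "T (i * p) = B"
    proof (induction i)
      case (Suc i)
      then show ?case using T_period[of "i * p"] by (simp add: add.commute)
    qed (simp add: T0)
    ultimately show ?thesis
      by (simp add: S_def emeasure_eq_measure mult.commute)
  qed
  then show ?thesis
    using M by (auto simp: ergodic_measures_def)
qed

text \<open>A continuous function separating all translates of \<open>M\<close> from all translates of \<open>N\<close> would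
  have different maximal integrals over the two orbits.\<close>

lemma mutually_dominating_same_orbit:
  assumes p: "p > 0"
    and M: "M \<in> invariant_measures X (f ^^ p)" and N: "N \<in> invariant_measures X (f ^^ p)"
    and domM: "\<And>L. L \<in> invariant_measures X (f ^^ p) \<Longrightarrow> dominates p M L"
    and domN: "\<And>L. L \<in> invariant_measures X (f ^^ p) \<Longrightarrow> dominates p N L"
  shows "\<exists>i<p. N = push M i"
proof -
  have Mb: "M \<in> borel_prob_measures X" and Nb: "N \<in> borel_prob_measures X" and Np: "push N p = N"
    using M N by (auto simp: invariant_iff_push)
  have "\<exists>i<p. \<exists>j<p. push M i = push N j"
  proof (rule ccontr)
    assume *: "\<not> ?thesis"
    define P where "P = (\<lambda>(i, j). (push M i, push N j)) ` ({..<p} \<times> {..<p})"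
    have "finite P" by (simp add: P_def)
    then obtain \<phi> :: "'a \<Rightarrow> real" where \<phi>: "continuous_on X \<phi>"
      and sep: "\<forall>(A, B)\<in>P. integral\<^sup>L A \<phi> \<noteq> integral\<^sup>L B \<phi>"
      using separating_continuous_function[OF compact, of P] push_borel_prob[OF Mb] push_borel_prob[OF Nb] *
      by (force simp: P_def)
    define m where "m = Max ((\<lambda>i. integral\<^sup>L (push M i) \<phi>) ` {..<p})"
    have m_ge: "integral\<^sup>L (push M i) \<phi> \<le> m" if "i < p" for i
      unfolding m_def using that by (intro Max_ge) auto
    have "m \<in> (\<lambda>i. integral\<^sup>L (push M i) \<phi>) ` {..<p}"
      unfolding m_def using p by (intro Max_in) auto
    then obtain i where i: "i < p" "m = integral\<^sup>L (push M i) \<phi>" by auto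
    obtain j where j: "j < p" "m \<le> integral\<^sup>L (push N j) \<phi>"
      using domN[OF invariant_push[OF M, of i]] \<phi> i by (auto simp: dominates_def)
    obtain i' where "i' < p" "integral\<^sup>L (push N j) \<phi> \<le> integral\<^sup>L (push M i') \<phi>"
      using domM[OF invariant_push[OF N, of j]] \<phi> by (auto simp: dominates_def)
    then have "integral\<^sup>L (push N j) \<phi> = integral\<^sup>L (push M i) \<phi>"
      using m_ge[of i'] i j by linarith
    moreover have "(push M i, push N j) \<in> P"
      using i j by (auto simp: P_def)
    ultimately show False using sep by force
  qed
  then obtain i j where ij: "j < p" "push M i = push N j" by blast
  \<comment> \<open>Translating by \<open>p - j\<close> completes a period and turns
    \<open>push N j\<close> back into \<open>N\<close>.\<close>
  have "push (push M i) (p - j) = push (push N j) (p - j)"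
    by (simp only: ij(2))
  then have "push M (i + (p - j)) = push N (j + (p - j))"
    unfolding push_push[OF Mb] push_push[OF Nb] .
  then have "N = push M (i + (p - j))"
    using ij(1) Np by simp
  then have "N = push M ((i + (p - j)) mod p)"
    by (simp only: push_mod[OF M])
  then show ?thesis
    using p by (intro exI[of _ "(i + (p - j)) mod p"]) simp
qed

text \<open>Any two limits at \<open>x\<close> dominate each other, so all are among the
  \<open>p\<close> translates of one limit \<open>M\<close>. Being finitely many, they reduce to
  \<open>M\<close>, which is ergodic by \<open>dominating_imp_ergodic\<close>.\<close>

lemma ergodic_generic_points_eqI:
  assumes p: "p > 0"
    and dom: "\<And>x M N. x \<in> X \<Longrightarrow> M \<in> empirical_limits X (f ^^ p) x \<Longrightarrow>
      N \<in> invariant_measures X (f ^^ p) \<Longrightarrow> dominates p M N"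
  shows "ergodic_generic_points X (f ^^ p) = X"
proof (intro equalityI subsetI)
  fix x assume x: "x \<in> X"
  interpret h: compact_selfmap X "f ^^ p" by (rule iterate_selfmap)
  obtain M where M: "M \<in> empirical_limits X (f ^^ p) x"
    using h.empirical_limits_nonempty[OF x] by blast
  have Minv: "M \<in> invariant_measures X (f ^^ p)"
    by (rule h.empirical_limits_invariant[OF x M])
  have "empirical_limits X (f ^^ p) x \<subseteq> push M ` {..<p}"
  proof
    fix N assume N: "N \<in> empirical_limits X (f ^^ p) x"
    have "\<exists>i<p. N = push M i"
      by (rule mutually_dominating_same_orbit[OF p Minv h.empirical_limits_invariant[OF x N]
            dom[OF x M] dom[OF x N]])
    then show "N \<in> push M ` {..<p}" by blast
  qed
  then have "finite (empirical_limits X (f ^^ p) x)"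
    by (rule finite_subset) simp
  then have "empirical_limits X (f ^^ p) x = {M}"
    using h.finite_empirical_limits_unique[OF x _ _ M] M by blast
  moreover have "M \<in> ergodic_measures X (f ^^ p)"
    by (rule dominating_imp_ergodic[OF p Minv dom[OF x M]])
  ultimately show "x \<in> ergodic_generic_points X (f ^^ p)"
    using x by (auto simp: ergodic_generic_points_def generic_points_def)
qed (auto simp: ergodic_generic_points_def generic_points_def)

section \<open>The largest of the Birkhoff averages over the \<open>p\<close> branches of an
  orbit\<close>

definition max_branch_average :: "nat \<Rightarrow> ('a \<Rightarrow> real) \<Rightarrow> nat \<Rightarrow> 'a \<Rightarrow> real" where
  "max_branch_average p \<phi> n x = Max ((\<lambda>i. orbit_average (f ^^ p) \<phi> n ((f ^^ i) x)) ` {..<p})"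

lemma orbit_average_le_max_branch:
  "i < p \<Longrightarrow> orbit_average (f ^^ p) \<phi> n ((f ^^ i) x) \<le> max_branch_average p \<phi> n x"
  unfolding max_branch_average_def by (intro Max_ge) auto

lemma max_branch_attained:
  assumes "p > 0"
  obtains i where "i < p" "max_branch_average p \<phi> n x = orbit_average (f ^^ p) \<phi> n ((f ^^ i) x)"
proof -
  have "max_branch_average p \<phi> n x \<in> (\<lambda>i. orbit_average (f ^^ p) \<phi> n ((f ^^ i) x)) ` {..<p}"
    unfolding max_branch_average_def using assms by (intro Max_in) auto
  then show thesis using that by auto
qed

lemma orbit_average_power_shift:
  assumes "x \<in> X" "\<And>y. y \<in> X \<Longrightarrow> \<bar>\<phi> y\<bar> \<le> B"
  shows "\<bar>orbit_average (f ^^ p) \<phi> n ((f ^^ p) x) - orbit_average (f ^^ p) \<phi> n x\<bar> \<le> 2 * B / n"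
proof -
  interpret h: compact_selfmap X "f ^^ p" by (rule iterate_selfmap)
  have "((f ^^ p) ^^ i) ((f ^^ p) x) = (f ^^ p) (((f ^^ p) ^^ i) x)" for i
    by (rule funpow_swap1[symmetric])
  then have "orbit_average (f ^^ p) \<phi> n ((f ^^ p) x) = orbit_average (f ^^ p) (\<lambda>y. \<phi> ((f ^^ p) y)) n x"
    by (simp add: orbit_average_def)
  then show ?thesis
    using h.orbit_average_shift[where \<phi>=\<phi> and B=B and n=n, OF assms] by simp
qed

text \<open>Replacing \<open>x\<close> by \<open>f x\<close> moves every branch index up by one. The
  only branch exchanged is 0 for \<open>p\<close>, and these are one step of \<open>f ^^ p\<close>
  apart, so their averages differ by at most \<open>2 * B / n\<close>. In the limit this becomes
  \<open>f\<close>-invariance.\<close>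

lemma max_branch_shift:
  assumes p: "p > 0" and x: "x \<in> X" and B: "\<And>y. y \<in> X \<Longrightarrow> \<bar>\<phi> y\<bar> \<le> B"
  shows "\<bar>max_branch_average p \<phi> n (f x) - max_branch_average p \<phi> n x\<bar> \<le> 2 * B / n"
proof -
  define a where "a i = orbit_average (f ^^ p) \<phi> n ((f ^^ i) x)" for i
  have B0: "0 \<le> 2 * B / n"
    using B[OF x] by simp
  have ap: "\<bar>a p - a 0\<bar> \<le> 2 * B / n"
    unfolding a_def using orbit_average_power_shift[where \<phi>=\<phi> and B=B and n=n, OF x B] by simp
  have le: "a i \<le> max_branch_average p \<phi> n x" if "i < p" for i
    unfolding a_def by (rule orbit_average_le_max_branch[OF that])
  have shift: "orbit_average (f ^^ p) \<phi> n ((f ^^ i) (f x)) = a (Suc i)" for i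
    unfolding a_def by (simp add: funpow_swap1)
  have le': "a (Suc i) \<le> max_branch_average p \<phi> n (f x)" if "i < p" for i
    using orbit_average_le_max_branch[OF that, of \<phi> n "f x"] by (simp only: shift)
  obtain i where i: "i < p" "max_branch_average p \<phi> n (f x) = a (Suc i)"
    using max_branch_attained[OF p, of \<phi> n "f x"] shift by metis
  obtain j where j: "j < p" "max_branch_average p \<phi> n x = a j"
    using max_branch_attained[OF p, of \<phi> n x] a_def by metis
  have "a (Suc i) \<le> max_branch_average p \<phi> n x + 2 * B / n"
  proof (cases "Suc i = p")
    case True
    then show ?thesis using ap le[OF p] by (simp add: abs_le_iff)
  next
    case False
    then show ?thesis using le[of "Suc i"] i(1) B0 by simp
  qed
  moreover have "a j \<le> max_branch_average p \<phi> n (f x) + 2 * B / n"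
  proof (cases j)
    case 0
    then show ?thesis using ap le'[of "p - 1"] p by (simp add: abs_le_iff)
  next
    case (Suc k)
    then show ?thesis using le'[of k] j(1) B0 by simp
  qed
  ultimately show ?thesis using i j by (simp add: abs_le_iff)
qed

lemma continuous_max_branch:
  assumes "continuous_on X \<phi>" "p > 0"
  shows "continuous_on X (max_branch_average p \<phi> n)"
proof -
  have branch: "continuous_on X (\<lambda>x. orbit_average (f ^^ p) \<phi> n ((f ^^ i) x))" for i
  proof -
    have "continuous_on X (\<lambda>x. \<phi> ((f ^^ (p * k + i)) x))" for k
      by (rule continuous_comp_iterate[OF assms(1)])
    then show ?thesis
      unfolding orbit_average_def divide_inverse
      by (intro continuous_intros) (auto simp: funpow_add funpow_mult)
  qed
  have "continuous_on X (\<lambda>x. Max ((\<lambda>i. orbit_average (f ^^ p) \<phi> n ((f ^^ i) x)) ` {..<q}))" if "q > 0" for q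
    using that
  proof (induction q rule: nat_induct_non_zero)
    case 1
    then show ?case using branch[of 0] by (simp add: lessThan_Suc)
  next
    case (Suc q)
    then have "Max ((\<lambda>i. orbit_average (f ^^ p) \<phi> n ((f ^^ i) x)) ` {..<Suc q}) =
        max (orbit_average (f ^^ p) \<phi> n ((f ^^ q) x)) (Max ((\<lambda>i. orbit_average (f ^^ p) \<phi> n ((f ^^ i) x)) ` {..<q}))" for x
      unfolding lessThan_Suc image_insert by (intro Max_insert) auto
    then show ?case using branch[of q] Suc.IH by (simp only:) (intro continuous_on_max)
  qed
  from this[OF assms(2)] show ?thesis
    unfolding max_branch_average_def[abs_def] .
qed

text \<open>All orbit averages of \<open>g\<close> at \<open>x\<close> equal \<open>g x\<close>, and these converge to its integral.\<close>

lemma uniquely_ergodic_invariant_constant: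
  assumes ue: "uniquely_ergodic X f" and g: "continuous_on X g" and inv: "\<And>x. x \<in> X \<Longrightarrow> g (f x) = g x"
  obtains c :: real where "\<And>x. x \<in> X \<Longrightarrow> g x = c"
proof -
  obtain \<mu> where \<mu>: "\<And>M. M \<in> invariant_measures X f \<Longrightarrow> M = \<mu>"
    using ue unfolding uniquely_ergodic_def by blast
  have "g x = integral\<^sup>L \<mu> g" if x: "x \<in> X" for x
  proof -
    obtain r M where "M \<in> empirical_limits X f x"
      and lim: "\<And>\<phi>. continuous_on X \<phi> \<Longrightarrow> (\<lambda>k. orbit_average f \<phi> (Suc (r k)) x) \<longlonglongrightarrow> integral\<^sup>L M \<phi>"
      using empirical_limits_cluster[OF x, of Suc] by blast
    then have "M = \<mu>"
      by (intro \<mu> empirical_limits_invariant[OF x])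
    have "g ((f ^^ i) x) = g x" for i
      by (induction i) (auto simp: inv iterate_mem x)
    then have "orbit_average f g (Suc n) x = g x" for n
      by (simp add: orbit_average_def del: of_nat_Suc)
    then show ?thesis
      using lim[OF g] \<open>M = \<mu>\<close> by (simp add: LIMSEQ_const_iff)
  qed
  then show thesis by (rule that)
qed

text \<open>The uniform limit of the branch maxima is a constant \<open>c\<close>. Integrating over
  \<open>N\<close> bounds the integral of \<open>\<phi>\<close> by \<open>c\<close>, while along the
  times approximating \<open>M\<close> the maximum at \<open>x\<close> stays near \<open>c\<close>,
  which forces one of the integrals of \<open>\<phi> \<circ> f ^^ i\<close> against \<open>M\<close>
  to reach \<open>c\<close>.\<close>

lemma dominates_if_uniform:
  assumes ue: "uniquely_ergodic X f" and p: "p > 0"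
    and unif: "\<And>\<phi> :: 'a \<Rightarrow> real. continuous_on X \<phi> \<Longrightarrow> (\<And>x. x \<in> X \<Longrightarrow> 0 \<le> \<phi> x) \<Longrightarrow>
      \<exists>g. uniform_limit X (max_branch_average p \<phi>) g sequentially"
    and x: "x \<in> X" and M: "M \<in> empirical_limits X (f ^^ p) x" and N: "N \<in> invariant_measures X (f ^^ p)"
  shows "dominates p M N"
proof -
  interpret h: compact_selfmap X "f ^^ p" by (rule iterate_selfmap)
  have Mb: "M \<in> borel_prob_measures X" and Nb: "N \<in> borel_prob_measures X" and Np: "push N p = N"
    using M N by (auto simp: invariant_iff_push empirical_limits_def)
  interpret M: prob_space M using borel_prob_measuresD[OF Mb] by simp
  interpret N: prob_space N using borel_prob_measuresD[OF Nb] by simp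
  have nonneg_case: "\<exists>i<p. integral\<^sup>L N \<phi> \<le> (\<integral>y. \<phi> ((f ^^ i) y) \<partial>M)"
    if \<phi>: "continuous_on X \<phi>" "\<And>x. x \<in> X \<Longrightarrow> 0 \<le> \<phi> x" for \<phi> :: "'a \<Rightarrow> real"
  proof (rule ccontr)
    assume "\<not> ?thesis"
    then have less: "\<And>i. i < p \<Longrightarrow> (\<integral>y. \<phi> ((f ^^ i) y) \<partial>M) < integral\<^sup>L N \<phi>" by force
    obtain B where B: "B > 0" "\<And>x. x \<in> X \<Longrightarrow> \<bar>\<phi> x\<bar> \<le> B"
      using continuous_bounded_on_compact[OF compact \<phi>(1)] by metis
    obtain g where g: "uniform_limit X (max_branch_average p \<phi>) g sequentially"
      using unif[OF \<phi>] by blast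
    have "continuous_on X g"
      by (rule uniform_limit_theorem[OF _ g]) (auto intro!: always_eventually continuous_max_branch[OF \<phi>(1) p])
    moreover have "g (f x) = g x" if "x \<in> X" for x
    proof -
      have fx: "f x \<in> X" using self that by auto
      have "(\<lambda>n. max_branch_average p \<phi> n (f x) - max_branch_average p \<phi> n x) \<longlonglongrightarrow> g (f x) - g x"
        by (intro tendsto_diff tendsto_uniform_limitI[OF g] that fx)
      moreover have "(\<lambda>n. max_branch_average p \<phi> n (f x) - max_branch_average p \<phi> n x) \<longlonglongrightarrow> 0"
        by (rule Lim_null_comparison[OF always_eventually lim_const_over_n])
          (use max_branch_shift[where \<phi>=\<phi> and B=B, OF p that B(2)] in auto)
      ultimately show ?thesis using LIMSEQ_unique by fastforce
    qed
    ultimately obtain c where c: "\<And>x. x \<in> X \<Longrightarrow> g x = c"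
      using uniquely_ergodic_invariant_constant[OF ue] by metis
    \<comment> \<open>By invariance of \<open>N\<close> each \<open>f ^^ p\<close>-average of
      \<open>\<phi>\<close> has the same integral as \<open>\<phi>\<close>, and uniform convergence
      bounds that average by \<open>c + e\<close> on all of \<open>X\<close>.\<close>
    have upper: "integral\<^sup>L N \<phi> \<le> c"
    proof (rule field_le_epsilon)
      fix e :: real assume "e > 0"
      then have "\<forall>\<^sub>F n in sequentially. \<forall>x\<in>X. dist (max_branch_average p \<phi> n x) (g x) < e"
        by (rule uniform_limitD[OF g])
      then have "\<forall>\<^sub>F n in sequentially. (\<forall>x\<in>X. dist (max_branch_average p \<phi> n x) (g x) < e) \<and> n > 0"
        by (intro eventually_conj eventually_gt_at_top)
      from eventually_happens'[OF sequentially_bot this]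
      obtain n where n: "\<And>x. x \<in> X \<Longrightarrow> dist (max_branch_average p \<phi> n x) (g x) < e" "n > 0"
        by blast
      have avg_le: "orbit_average (f ^^ p) \<phi> n y \<le> c + e" if "y \<in> X" for y
        using orbit_average_le_max_branch[OF p, of \<phi> n y] n(1)[OF that] c[OF that]
        by (simp add: dist_real_def abs_less_iff)
      have int_iter: "(\<integral>y. \<phi> (((f ^^ p) ^^ k) y) \<partial>N) = integral\<^sup>L N \<phi>" for k
        using integral_push[OF Nb \<phi>(1), of "p * k"] push_mod[OF N, of "p * k"]
        by (simp add: funpow_mult push_0[OF Nb])
      have "integral\<^sup>L N \<phi> = (\<integral>y. orbit_average (f ^^ p) \<phi> n y \<partial>N)"
        unfolding orbit_average_def using n(2)
        by (simp add: int_iter integrable_continuous[OF compact Nb h.continuous_comp_iterate[OF \<phi>(1)]])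
      also have "\<dots> \<le> (\<integral>y. c + e \<partial>N)"
      proof (rule integral_mono)
        show "integrable N (orbit_average (f ^^ p) \<phi> n)"
          unfolding orbit_average_def[abs_def]
          by (simp add: integrable_continuous[OF compact Nb h.continuous_comp_iterate[OF \<phi>(1)]])
      qed (use avg_le borel_prob_measuresD(3)[OF Nb] in auto)
      finally show "integral\<^sup>L N \<phi> \<le> c + e" by (simp add: N.prob_space)
    qed
    \<comment> \<open>The margin is \<open>2 * e\<close>: one \<open>e\<close> for the distance from
      a branch average to its integral, one for the distance from the maximum to
      \<open>c\<close>.\<close>
    then have less_c: "\<forall>\<^sub>F e in at_right 0. \<forall>i\<in>{..<p}. (\<integral>y. \<phi> ((f ^^ i) y) \<partial>M) + 2 * e < c"
    proof (intro eventually_ball_finite ballI)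
      fix i assume "i \<in> {..<p}"
      then have "(\<integral>y. \<phi> ((f ^^ i) y) \<partial>M) < c" using less[of i] upper by simp
      then show "\<forall>\<^sub>F e in at_right 0. (\<integral>y. \<phi> ((f ^^ i) y) \<partial>M) + 2 * e < c"
        by (intro eventually_at_rightI[of 0 "(c - (\<integral>y. \<phi> ((f ^^ i) y) \<partial>M)) / 2"]) (auto simp: field_simps)
    qed simp
    have "\<forall>\<^sub>F e in at_right (0::real). (\<forall>i\<in>{..<p}. (\<integral>y. \<phi> ((f ^^ i) y) \<partial>M) + 2 * e < c) \<and> e > 0"
      by (intro eventually_conj less_c) (simp add: eventually_at_right_less)
    from eventually_happens'[OF _ this]
    obtain e where e: "\<And>i. i < p \<Longrightarrow> (\<integral>y. \<phi> ((f ^^ i) y) \<partial>M) + 2 * e < c" "e > 0"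
      by auto
    define \<Phi> where "\<Phi> = (\<lambda>i y. \<phi> ((f ^^ i) y)) ` {..<p}"
    have "\<exists>\<^sub>F n in sequentially. \<forall>\<psi>\<in>\<Phi>. \<bar>orbit_average (f ^^ p) \<psi> n x - integral\<^sup>L M \<psi>\<bar> < e"
      by (rule h.empirical_limits_frequently[OF x M])
        (auto simp: \<Phi>_def e continuous_comp_iterate[OF \<phi>(1)])
    moreover have "\<forall>\<^sub>F n in sequentially. \<forall>x\<in>X. dist (max_branch_average p \<phi> n x) (g x) < e"
      by (rule uniform_limitD[OF g e(2)])
    ultimately have "\<exists>\<^sub>F n in sequentially. (\<forall>\<psi>\<in>\<Phi>. \<bar>orbit_average (f ^^ p) \<psi> n x - integral\<^sup>L M \<psi>\<bar> < e)
        \<and> (\<forall>x\<in>X. dist (max_branch_average p \<phi> n x) (g x) < e)"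
      by (rule frequently_eventually_frequently)
    then obtain n where n1: "\<And>\<psi>. \<psi> \<in> \<Phi> \<Longrightarrow> \<bar>orbit_average (f ^^ p) \<psi> n x - integral\<^sup>L M \<psi>\<bar> < e"
      and n2: "dist (max_branch_average p \<phi> n x) (g x) < e"
      using x frequently_ex by (metis (no_types, lifting))
    obtain i where i: "i < p" "max_branch_average p \<phi> n x = orbit_average (f ^^ p) \<phi> n ((f ^^ i) x)"
      using max_branch_attained[OF p, of \<phi> n x] by metis
    \<comment> \<open>Since \<open>f ^^ i\<close> commutes with \<open>f ^^ p\<close>, the branch
      starting at \<open>f ^^ i\<close> of \<open>x\<close> is the orbit of \<open>x\<close> tested
      with \<open>\<phi> \<circ> f ^^ i\<close>, so the one limit \<open>M\<close> at
      \<open>x\<close> controls all branches.\<close>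
    have "((f ^^ p) ^^ k) ((f ^^ i) x) = (f ^^ i) (((f ^^ p) ^^ k) x)" for k
      unfolding funpow_mult comp_apply[of "f ^^ _" "f ^^ _", symmetric] funpow_add[symmetric]
      by (simp add: add.commute)
    then have "orbit_average (f ^^ p) \<phi> n ((f ^^ i) x) = orbit_average (f ^^ p) (\<lambda>y. \<phi> ((f ^^ i) y)) n x"
      by (simp add: orbit_average_def)
    moreover have "\<bar>orbit_average (f ^^ p) (\<lambda>y. \<phi> ((f ^^ i) y)) n x - (\<integral>y. \<phi> ((f ^^ i) y) \<partial>M)\<bar> < e"
      using n1[of "\<lambda>y. \<phi> ((f ^^ i) y)"] i(1) by (auto simp: \<Phi>_def)
    ultimately show False
      using e(1)[OF i(1)] i(2) n2 c[OF x] unfolding dist_real_def by linarith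
  qed
  show ?thesis
    unfolding dominates_def
  proof (intro allI impI)
    fix \<phi> :: "'a \<Rightarrow> real" assume \<phi>: "continuous_on X \<phi>"
    obtain B where B: "B > 0" "\<And>x. x \<in> X \<Longrightarrow> \<bar>\<phi> x\<bar> \<le> B"
      using continuous_bounded_on_compact[OF compact \<phi>] by metis
    \<comment> \<open>Adding \<open>B\<close> makes the function nonnegative, and the constant
      cancels because both measures have mass 1.\<close>
    have "continuous_on X (\<lambda>x. \<phi> x + B)" by (intro continuous_intros \<phi>)
    moreover have "0 \<le> \<phi> x + B" if "x \<in> X" for x using B(2)[OF that] by linarith
    ultimately obtain i where i: "i < p" "(\<integral>x. \<phi> x + B \<partial>N) \<le> (\<integral>y. \<phi> ((f ^^ i) y) + B \<partial>M)"
      using nonneg_case[of "\<lambda>x. \<phi> x + B"] by blast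
    moreover have "(\<integral>x. \<phi> x + B \<partial>N) = integral\<^sup>L N \<phi> + B"
      using integrable_continuous[OF compact Nb \<phi>] by (simp add: N.prob_space)
    moreover have "(\<integral>y. \<phi> ((f ^^ i) y) + B \<partial>M) = (\<integral>y. \<phi> ((f ^^ i) y) \<partial>M) + B"
      using integrable_continuous[OF compact Mb continuous_comp_iterate[OF \<phi>]] by (simp add: M.prob_space)
    ultimately show "\<exists>i<p. integral\<^sup>L N \<phi> \<le> integral\<^sup>L (push M i) \<phi>"
      by (auto simp: integral_push[OF Mb \<phi>])
  qed
qed

end

section \<open>Cyclic monomial cocycles\<close>

text \<open>Indexing the weights by columns makes a product collect them along the forward orbit of
  \<open>\<sigma>\<close>.\<close>

definition monomial_matrix :: "('m \<Rightarrow> 'm) \<Rightarrow> ('m \<Rightarrow> real) \<Rightarrow> real^'m^'m::finite" where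
  "monomial_matrix \<sigma> w = (\<chi> i j. if i = \<sigma> j then w j else 0)"

lemma monomial_matrix_mult:
  "monomial_matrix \<sigma> v ** monomial_matrix \<tau> w = monomial_matrix (\<sigma> \<circ> \<tau>) (\<lambda>j. v (\<tau> j) * w j)"
  unfolding monomial_matrix_def matrix_matrix_mult_def vec_eq_iff
  by (simp add: if_distrib[of "\<lambda>t. _ * t"] sum.delta' cong: if_cong)

lemma monomial_matrix_id: "monomial_matrix id (\<lambda>_. 1) = mat 1"
  by (simp add: monomial_matrix_def mat_def)

lemma invertible_monomial_matrix:
  assumes "bij \<sigma>" "\<And>j. w j \<noteq> 0"
  shows "invertible (monomial_matrix \<sigma> w)"
proof -
  let ?B = "monomial_matrix (inv \<sigma>) (\<lambda>j. 1 / w (inv \<sigma> j))"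
  have "\<sigma> \<circ> inv \<sigma> = id" "inv \<sigma> \<circ> \<sigma> = id" "\<And>j. inv \<sigma> (\<sigma> j) = j"
    using assms(1) by (auto simp: bij_def surj_iff)
  then have "monomial_matrix \<sigma> w ** ?B = mat 1" "?B ** monomial_matrix \<sigma> w = mat 1"
    by (simp_all add: monomial_matrix_mult assms(2) monomial_matrix_id)
  then show ?thesis unfolding invertible_def by blast
qed

lemma cocycle_monomial:
  "cocycle f (\<lambda>x. monomial_matrix \<sigma> (w x)) n x =
    monomial_matrix (\<sigma> ^^ n) (\<lambda>j. \<Prod>k<n. w ((f ^^ k) x) ((\<sigma> ^^ k) j))"
proof (induction n)
  case 0
  show ?case by (simp add: monomial_matrix_id[symmetric] id_def)
next
  case (Suc n)
  then show ?case by (simp add: monomial_matrix_mult comp_def mult.commute)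
qed

lemma norm_monomial_matrix_ge: "\<bar>w j\<bar> \<le> norm (monomial_matrix \<sigma> w)"
proof -
  have "\<bar>w j\<bar> = norm (monomial_matrix \<sigma> w $ \<sigma> j $ j)"
    by (simp add: monomial_matrix_def)
  also have "\<dots> \<le> norm (monomial_matrix \<sigma> w)"
    by (rule order_trans[OF Finite_Cartesian_Product.norm_nth_le Finite_Cartesian_Product.norm_nth_le])
  finally show ?thesis .
qed

lemma norm_monomial_matrix_le:
  fixes w :: "'m::finite \<Rightarrow> real"
  assumes "\<And>j. \<bar>w j\<bar> \<le> B"
  shows "norm (monomial_matrix \<sigma> w) \<le> real CARD('m) ^ 2 * B"
proof -
  have "0 \<le> B" using assms[of undefined] by linarith
  then have entry: "\<bar>monomial_matrix \<sigma> w $ i $ j\<bar> \<le> B" for i j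
    using assms by (simp add: monomial_matrix_def)
  have "norm (monomial_matrix \<sigma> w) \<le> (\<Sum>i\<in>UNIV. norm (monomial_matrix \<sigma> w $ i))"
    unfolding norm_vec_def[of "monomial_matrix \<sigma> w"] by (rule L2_set_le_sum) simp
  also have "\<dots> \<le> (\<Sum>i\<in>(UNIV::'m set). \<Sum>j\<in>(UNIV::'m set). B)"
    by (intro sum_mono order_trans[OF norm_le_l1_cart] entry)
  finally show ?thesis by (simp add: power2_eq_square)
qed

text \<open>The cycle of length \<open>p\<close> is \<open>\<sigma> = inv \<rho>\<close>, where \<open>\<rho>\<close> rotates the first \<open>p\<close> indices.\<close>

lemma cyclic_permutation:
  assumes p: "p > 0" "p \<le> CARD('m::finite)"
  obtains \<sigma> :: "'m::finite \<Rightarrow> 'm" and j0 where "bij \<sigma>"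
    "\<And>i. i < p \<Longrightarrow> \<exists>j. \<forall>k. (\<sigma> ^^ k) j = j0 \<longleftrightarrow> k mod p = i"
    "\<And>j. (\<exists>i<p. \<forall>k. (\<sigma> ^^ k) j = j0 \<longleftrightarrow> k mod p = i) \<or> (\<forall>k. (\<sigma> ^^ k) j \<noteq> j0)"
proof -
  obtain e :: "'m \<Rightarrow> nat" where e: "bij_betw e UNIV {0..<CARD('m)}"
    using ex_bij_betw_finite_nat[of "UNIV :: 'm set"] by auto
  define E where "E = inv_into UNIV e"
  have eE: "e (E q) = q" if "q < p" for q
    unfolding E_def using that p(2) e by (intro f_inv_into_f) (auto simp: bij_betw_def)
  have Ee: "E (e j) = j" for j
    unfolding E_def using e by (intro inv_into_f_f) (auto simp: bij_betw_def)
  define \<rho> where "\<rho> j = (if e j < p then E (Suc (e j) mod p) else j)" for j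
  have mp: "n mod p < p" for n using p(1) by simp
  have "inj \<rho>"
  proof (rule injI)
    fix a b assume eq: "\<rho> a = \<rho> b"
    have e\<rho>: "e (\<rho> j) = (if e j < p then Suc (e j) mod p else e j)" for j
      by (simp add: \<rho>_def eE mp)
    have "e a = e b"
      using arg_cong[OF eq, of e] p(1) mp[of "Suc (e a)"] mp[of "Suc (e b)"]
      unfolding e\<rho> by (auto simp: mod_Suc split: if_splits)
    then show "a = b" by (metis Ee)
  qed
  then have bij: "bij \<rho>" by (simp add: bij_def finite_UNIV_inj_surj)
  have orbit: "(\<rho> ^^ k) (E 0) = E (k mod p)" for k
  proof (induction k)
    case (Suc k)
    then show ?case by (simp add: \<rho>_def eE mp mod_Suc_eq)
  qed simp
  \<comment> \<open>Running the rotation backwards, the orbit of \<open>E i\<close> meets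
    \<open>E 0\<close> exactly at the times congruent to \<open>i\<close>; with
    \<open>\<rho>\<close> itself they would be congruent to \<open>-i\<close>.\<close>
  have hit: "((inv \<rho>) ^^ k) j = E 0 \<longleftrightarrow> j = E (k mod p)" for j k
  proof -
    have "((inv \<rho>) ^^ k) j = E 0 \<longleftrightarrow> E 0 = inv (\<rho> ^^ k) j"
      by (simp only: inv_fn[OF bij]) (rule eq_commute)
    also have "\<dots> \<longleftrightarrow> (\<rho> ^^ k) (E 0) = j"
      by (rule bij_inv_eq_iff[OF bij_fn[OF bij]])
    finally show ?thesis by (auto simp: orbit)
  qed
  have E_inj: "E i = E i' \<longleftrightarrow> i = i'" if "i < p" "i' < p" for i i'
    using eE that by metis
  show thesis
  proof (rule that[of "inv \<rho>" "E 0"])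
    show "bij (inv \<rho>)" using bij by (rule bij_imp_bij_inv)
    show "\<exists>j. \<forall>k. ((inv \<rho>) ^^ k) j = E 0 \<longleftrightarrow> k mod p = i" if "i < p" for i
      unfolding hit using that by (intro exI[of _ "E i"]) (auto simp: E_inj mp)
    show "(\<exists>i<p. \<forall>k. ((inv \<rho>) ^^ k) j = E 0 \<longleftrightarrow> k mod p = i) \<or> (\<forall>k. ((inv \<rho>) ^^ k) j \<noteq> E 0)" for j
    proof (cases "e j < p")
      case True
      then have "\<forall>k. ((inv \<rho>) ^^ k) j = E 0 \<longleftrightarrow> k mod p = e j"
        unfolding hit using E_inj[of "e j"] mp Ee[of j] by auto
      then show ?thesis using True by blast
    next
      case False
      then have "\<forall>k. ((inv \<rho>) ^^ k) j \<noteq> E 0"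
        unfolding hit using eE[OF mp] mp by (metis (no_types))
      then show ?thesis by blast
    qed
  qed
qed

lemma sum_residue_class:
  fixes F :: "nat \<Rightarrow> real"
  assumes "i < p"
  shows "(\<Sum>k<p * N. if k mod p = i then F k else 0) = (\<Sum>l<N. F (p * l + i))"
proof (induction N)
  case (Suc N)
  have "(\<Sum>k<p * Suc N. if k mod p = i then F k else 0) =
      (\<Sum>k<p * N. if k mod p = i then F k else 0) + (\<Sum>k=p * N..<p * N + p. if k mod p = i then F k else 0)"
    using sum.atLeastLessThan_concat[of 0 "p * N" "p * N + p" "\<lambda>k. if k mod p = i then F k else 0"]
    by (simp add: atLeast0LessThan add.commute)
  also have "(\<Sum>k=p * N..<p * N + p. if k mod p = i then F k else 0) = (\<Sum>r<p. if (r + p * N) mod p = i then F (r + p * N) else 0)"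
    using sum.shift_bounds_nat_ivl[of "\<lambda>k. if k mod p = i then F k else 0" 0 "p * N" p]
    by (simp add: atLeast0LessThan add.commute)
  also have "\<dots> = (\<Sum>r<p. if r = i then F (r + p * N) else 0)"
    by (intro sum.cong) auto
  also have "\<dots> = F (p * N + i)"
    using assms by (simp add: sum.delta add.commute)
  finally show ?case using Suc.IH by simp
qed simp

section \<open>Growth rate of the cyclic cocycle\<close>

context compact_selfmap
begin

text \<open>Column \<open>j\<close> of the product has one nonzero entry, the exponential of
  \<open>\<phi>\<close> summed over the visits of \<open>j\<close> to \<open>j0\<close>. On the
  cycle these visits fill one residue class modulo \<open>p\<close>, giving \<open>N\<close> times a
  branch average; off the cycle the entry is 1, which stays below the maximum as
  \<open>\<phi> \<ge> 0\<close>. The norm lies between the largest entry and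
  \<open>CARD('m)^2\<close> times it.\<close>

lemma ln_norm_cyclic_cocycle:
  fixes \<sigma> :: "'m::finite \<Rightarrow> 'm" and \<phi> :: "'a \<Rightarrow> real"
  assumes p: "p > 0" and nonneg: "\<And>x. x \<in> X \<Longrightarrow> 0 \<le> \<phi> x" and x: "x \<in> X" and N: "N > 0"
    and hit: "\<And>i. i < p \<Longrightarrow> \<exists>j. \<forall>k. (\<sigma> ^^ k) j = j0 \<longleftrightarrow> k mod p = i"
    and hit': "\<And>j. (\<exists>i<p. \<forall>k. (\<sigma> ^^ k) j = j0 \<longleftrightarrow> k mod p = i) \<or> (\<forall>k. (\<sigma> ^^ k) j \<noteq> j0)"
  defines "A \<equiv> \<lambda>x. monomial_matrix \<sigma> (\<lambda>j. if j = j0 then exp (\<phi> x) else 1)"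
  shows "\<bar>ln (norm (cocycle f A (p * N) x)) - N * max_branch_average p \<phi> N x\<bar> \<le> ln (real CARD('m) ^ 2)"
proof -
  define m where "m = max_branch_average p \<phi> N x"
  define W where "W j = (\<Sum>k<p * N. if (\<sigma> ^^ k) j = j0 then \<phi> ((f ^^ k) x) else 0)" for j
  have coc: "cocycle f A (p * N) x = monomial_matrix (\<sigma> ^^ (p * N)) (\<lambda>j. exp (W j))"
    unfolding A_def cocycle_monomial W_def exp_sum[OF finite_lessThan]
    by (intro arg_cong[where f="monomial_matrix _"] ext prod.cong) auto
  have W_branch: "W j = N * orbit_average (f ^^ p) \<phi> N ((f ^^ i) x)"
    if "i < p" "\<forall>k. (\<sigma> ^^ k) j = j0 \<longleftrightarrow> k mod p = i" for i j
  proof -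
    have "W j = (\<Sum>l<N. \<phi> ((f ^^ (p * l + i)) x))"
      unfolding W_def using that(2) sum_residue_class[OF that(1), of "\<lambda>k. \<phi> ((f ^^ k) x)" N] by simp
    then show ?thesis
      using N by (simp add: orbit_average_def funpow_add funpow_mult)
  qed
  have avg_nonneg: "0 \<le> orbit_average (f ^^ p) \<phi> N ((f ^^ i) x)" for i
    unfolding orbit_average_def funpow_mult
    by (intro divide_nonneg_nonneg sum_nonneg nonneg iterate_mem x) simp
  then have m0: "0 \<le> m"
    unfolding m_def using order_trans[OF _ orbit_average_le_max_branch[OF p]] by blast
  have upper: "W j \<le> N * m" for j
    using hit'[of j]
  proof
    assume "\<exists>i<p. \<forall>k. (\<sigma> ^^ k) j = j0 \<longleftrightarrow> k mod p = i"
    then obtain i where "i < p" "W j = N * orbit_average (f ^^ p) \<phi> N ((f ^^ i) x)"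
      using W_branch by blast
    then show ?thesis
      using orbit_average_le_max_branch[of i p \<phi> N x] by (simp add: m_def mult_left_mono)
  next
    assume "\<forall>k. (\<sigma> ^^ k) j \<noteq> j0"
    then show ?thesis using m0 by (simp add: W_def)
  qed
  obtain i where i: "i < p" "m = orbit_average (f ^^ p) \<phi> N ((f ^^ i) x)"
    unfolding m_def using max_branch_attained[OF p] by metis
  then obtain j where "W j = N * m"
    using hit[OF i(1)] W_branch by blast
  then have lower: "exp (N * m) \<le> norm (cocycle f A (p * N) x)"
    unfolding coc using norm_monomial_matrix_ge[of "\<lambda>j. exp (W j)" j] by simp
  have "norm (cocycle f A (p * N) x) \<le> real CARD('m) ^ 2 * exp (N * m)"
    unfolding coc by (rule norm_monomial_matrix_le) (simp add: upper)
  moreover have pos: "0 < norm (cocycle f A (p * N) x)"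
    using lower exp_gt_zero less_le_trans by blast
  ultimately have "ln (norm (cocycle f A (p * N) x)) \<le> ln (real CARD('m) ^ 2 * exp (N * m))"
    by (simp del: zero_less_norm_iff)
  also have "\<dots> = ln (real CARD('m) ^ 2) + N * m"
    by (subst ln_mult) auto
  finally have "ln (norm (cocycle f A (p * N) x)) \<le> ln (real CARD('m) ^ 2) + N * m" .
  moreover have "N * m \<le> ln (norm (cocycle f A (p * N) x))"
    using lower pos by (simp add: ln_ge_iff)
  moreover have "0 \<le> ln (real CARD('m) ^ 2)"
    by (intro ln_ge_zero one_le_power) (simp add: Suc_leI)
  ultimately show ?thesis by (simp add: m_def abs_le_iff)
qed

text \<open>Along the times \<open>p * N\<close> the bounded error of
  \<open>ln_norm_cyclic_cocycle\<close> disappears after division by \<open>N\<close>. The factor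
  \<open>p\<close> in the limit converts growth per step of \<open>f\<close> into growth per step of
  \<open>f ^^ p\<close>, which is why the tolerance for \<open>l\<close> is
  \<open>e / (2 * p)\<close>.\<close>

lemma max_branch_uniform:
  fixes \<phi> :: "'a \<Rightarrow> real"
  assumes all_uniform: "\<And>A :: 'a \<Rightarrow> real^'m^'m::finite. A \<in> continuous_GL X \<Longrightarrow> uniform_cocycle X f A"
    and p: "p > 0" "p \<le> CARD('m)"
    and \<phi>: "continuous_on X \<phi>" "\<And>x. x \<in> X \<Longrightarrow> 0 \<le> \<phi> x"
  shows "\<exists>g. uniform_limit X (max_branch_average p \<phi>) g sequentially"
proof -
  obtain \<sigma> :: "'m \<Rightarrow> 'm" and j0 where \<sigma>: "bij \<sigma>"
    and hit: "\<And>i. i < p \<Longrightarrow> \<exists>j. \<forall>k. (\<sigma> ^^ k) j = j0 \<longleftrightarrow> k mod p = i"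
    and hit': "\<And>j. (\<exists>i<p. \<forall>k. (\<sigma> ^^ k) j = j0 \<longleftrightarrow> k mod p = i) \<or> (\<forall>k. (\<sigma> ^^ k) j \<noteq> j0)"
    using cyclic_permutation[OF p] by blast
  define A where "A x = monomial_matrix \<sigma> (\<lambda>j. if j = j0 then exp (\<phi> x) else 1)" for x
  have "continuous_on X A"
    unfolding A_def monomial_matrix_def
  proof (intro continuous_on_vec_lambda)
    fix i j
    show "continuous_on X (\<lambda>x. if i = \<sigma> j then if j = j0 then exp (\<phi> x) else 1 else 0)"
      using \<phi>(1) by (cases "i = \<sigma> j"; cases "j = j0") (auto intro!: continuous_intros)
  qed
  then have "A \<in> continuous_GL X"
    unfolding continuous_GL_def A_def using \<sigma> by (auto intro!: invertible_monomial_matrix split: if_splits)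
  then obtain l where l: "uniform_limit X (\<lambda>n x. ln (norm (cocycle f A n x)) / real n) l sequentially"
    using all_uniform unfolding uniform_cocycle_def uniformly_convergent_on_def by blast
  have "filterlim (\<lambda>N. p * N) at_top sequentially"
    by (rule filterlim_at_top_mono[OF filterlim_ident]) (use p in \<open>auto intro!: always_eventually\<close>)
  then have lp: "uniform_limit X (\<lambda>N x. ln (norm (cocycle f A (p * N) x)) / real (p * N)) l sequentially"
    by (rule filterlim_compose[OF l])
  define C where "C = ln (real CARD('m) ^ 2)"
  have "uniform_limit X (max_branch_average p \<phi>) (\<lambda>x. p * l x) sequentially"
  proof (rule uniform_limitI)
    fix e :: real assume e: "e > 0"
    have "\<forall>\<^sub>F N in sequentially. \<forall>x\<in>X. dist (ln (norm (cocycle f A (p * N) x)) / real (p * N)) (l x) < e / (2 * p)"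
      by (rule uniform_limitD[OF lp]) (use e p in simp)
    moreover have "\<forall>\<^sub>F N in sequentially. C / real N < e / 2"
      using e by (intro order_tendstoD(2)[OF lim_const_over_n]) simp
    moreover have "\<forall>\<^sub>F N in sequentially. (N::nat) > 0" by (rule eventually_gt_at_top)
    ultimately show "\<forall>\<^sub>F N in sequentially. \<forall>x\<in>X. dist (max_branch_average p \<phi> N x) (p * l x) < e"
    proof eventually_elim
      case (elim N)
      show ?case
      proof
        fix x assume x: "x \<in> X"
        define L where "L = ln (norm (cocycle f A (p * N) x))"
        have "\<bar>L - N * max_branch_average p \<phi> N x\<bar> \<le> C"
          unfolding L_def C_def A_def[abs_def]
          by (rule ln_norm_cyclic_cocycle[OF p(1) \<phi>(2) x elim(3) hit hit'])
        then have "\<bar>L - N * max_branch_average p \<phi> N x\<bar> / N \<le> C / N"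
          by (rule divide_right_mono) simp
        moreover have "L / N - max_branch_average p \<phi> N x = (L - N * max_branch_average p \<phi> N x) / N"
          using elim(3) by (simp add: field_simps)
        then have "\<bar>L - N * max_branch_average p \<phi> N x\<bar> / N = \<bar>L / N - max_branch_average p \<phi> N x\<bar>"
          by (simp add: abs_divide)
        ultimately have 1: "\<bar>L / N - max_branch_average p \<phi> N x\<bar> < e / 2"
          using elim(2) by linarith
        have "\<bar>L / (p * N) - l x\<bar> < e / (2 * p)"
          using elim(1) x by (auto simp: dist_real_def L_def)
        then have "p * \<bar>L / (p * N) - l x\<bar> < e / 2"
          using p by (simp add: field_simps)
        moreover have "p * \<bar>L / (p * N) - l x\<bar> = \<bar>L / N - p * l x\<bar>"
          using p(1) by (subst abs_of_nat[symmetric], subst abs_mult[symmetric]) (simp add: right_diff_distrib)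
        ultimately have "\<bar>L / N - p * l x\<bar> < e / 2" by (simp only:)
        with 1 have "\<bar>max_branch_average p \<phi> N x - p * l x\<bar> < e / 2 + e / 2" by arith
        then show "dist (max_branch_average p \<phi> N x) (p * l x) < e"
          by (simp add: dist_real_def)
      qed
    qed
  qed
  then show ?thesis by (intro exI[of _ "\<lambda>x. p * l x"])
qed

end

theorem theorem3:
  fixes X :: "'a::metric_space set" and f :: "'a \<Rightarrow> 'a" and p :: nat
  assumes "dynamical_system X f"
    and "uniquely_ergodic X f"
    and "prime p"
    and "ergodic_generic_points X (f ^^ p) \<noteq> X"
    and "p \<le> CARD('m::finite)"
  shows "\<exists>A :: 'a \<Rightarrow> real^'m^'m. A \<in> continuous_GL X \<and> \<not> uniform_cocycle X f A"
proof (rule ccontr)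
  assume "\<not> ?thesis"
  then have all_uniform: "\<And>A :: 'a \<Rightarrow> real^'m^'m. A \<in> continuous_GL X \<Longrightarrow> uniform_cocycle X f A"
    by blast
  interpret compact_selfmap X f
    using assms(1) by unfold_locales (auto simp: dynamical_system_def homeomorphism_def)
  have p: "p > 0" using assms(3) by (rule prime_gt_0_nat)
  \<comment> \<open>Uniformity of all cocycles gives uniform branch maxima, these give domination by
    every empirical limit, and domination makes every point generic for an ergodic measure.\<close>
  have "ergodic_generic_points X (f ^^ p) = X"
    by (intro ergodic_generic_points_eqI[OF p] dominates_if_uniform[OF assms(2) p]
        max_branch_uniform[OF all_uniform p assms(5)])
  with assms(4) show False ..
qed

end
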